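(* For every $n\ge2$, every integer $1\le k<n$, every unconditional convex body $L$ in $\mathbb{R}^n$, and every measure $\mu$ with even continuous non-negative density on $L$, $$\mu(L)\ \le\ e^k\,\frac{n}{n-k}\,c_{n,k}\,\max_{H\in Gr_{n-k}}\mu(L\cap H)\,|L|^{k/n}.$$
   Context: A convex body $L$ in $\mathbb{R}^n$ (compact convex set with non-empty interior containing the origin in its interior) is unconditional if $\|\sum_{i=1}^n\delta_ix_ie_i\|_L=\|\sum_{i=1}^n x_ie_i\|_L$ for all real $x_i$ and all signs $\delta_i=\pm1$, where $e_1,\dots,e_n$ is the standard basis and $\|x\|_L=\min\{a\ge0:x\in aL\}$. $Gr_{n-k}$ is the Grassmannian of $(n-k)$-dimensional linear subspaces of $\mathbb{R}^n$. If $\mu$ has density $g$, $\mu(L)=\int_L g$ and $\mu(L\cap H)=\int_{L\cap H}g$ with respect to $(n-k)$-dimensional Lebesgue measure on $H$. $|L|$ is volume, $B_2^m$ the Euclidean unit ball in $\mathbb{R}^m$, and $c_{n,k}=|B_2^n|^{\frac{n-k}{n}}/|B_2^{n-k}|$. *)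

theory Defs
  imports "HOL-Analysis.Analysis"
begin

definition gauge_of :: "'a::euclidean_space set \<Rightarrow> 'a \<Rightarrow> real" where
  "gauge_of L x = Inf {a. a \<ge> 0 \<and> x \<in> (\<lambda>y. a *\<^sub>R y) ` L}"

definition convex_body :: "'a::euclidean_space set \<Rightarrow> bool" where
  "convex_body L \<longleftrightarrow> compact L \<and> convex L \<and> 0 \<in> interior L"

definition unconditional :: "'a::euclidean_space set \<Rightarrow> bool" where
  "unconditional L \<longleftrightarrow>
     (\<forall>x (\<delta>::'a \<Rightarrow> real). (\<forall>i\<in>Basis. \<delta> i = 1 \<or> \<delta> i = -1) \<longrightarrow>
        gauge_of L (\<Sum>i\<in>Basis. (\<delta> i * (x \<bullet> i)) *\<^sub>R i) = gauge_of L x)"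

definition Grass :: "nat \<Rightarrow> 'a::euclidean_space set set" where
  "Grass m = {H. subspace H \<and> dim H = m}"

definition onb_of :: "'a::euclidean_space set \<Rightarrow> (nat \<Rightarrow> 'a) \<Rightarrow> bool" where
  "onb_of H b \<longleftrightarrow> (\<forall>i<dim H. \<forall>j<dim H. b i \<bullet> b j = (if i = j then 1 else 0))
                    \<and> span (b ` {..<dim H}) = H"

text \<open>Integral of g over L \<inter> H with respect to dim(H)-dimensional Lebesgue measure on H,
  computed by the isometric parametrisation t \<mapsto> \<Sum> t_i b_i of H by R^{dim H}
  (independent of the chosen orthonormal basis).\<close>
definition section_integral :: "('a::euclidean_space \<Rightarrow> real) \<Rightarrow> 'a set \<Rightarrow> 'a set \<Rightarrow> real" where
  "section_integral g L H =
     (let m = dim H; b = (SOME b. onb_of H b) in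
       integral\<^sup>L (PiM {..<m} (\<lambda>_. lborel))
         (\<lambda>t. indicator L (\<Sum>i<m. t i *\<^sub>R b i) * g (\<Sum>i<m. t i *\<^sub>R b i)))"

definition c_nk :: "nat \<Rightarrow> nat \<Rightarrow> real" where
  "c_nk n k = unit_ball_vol (real n) powr ((real n - real k) / real n) / unit_ball_vol (real n - real k)"

end

theory Submission
  imports Defs "HOL-Real_Asymp.Real_Asymp"
begin

text \<open>
  Let the box \<open>[-a, a]\<close> have largest volume among the coordinate boxes in \<open>L\<close>. First-order
  optimality puts \<open>L\<close> inside the cross-polytope \<open>D = {N \<le> 1}\<close> with \<open>N x = \<Sum>i. \<bar>x \<bullet> i\<bar> / (n a\<^sub>i)\<close>,
  and \<open>|D| \<le> e\<^sup>n |L|\<close> by Markov's inequality for \<open>exp (- n N)\<close>.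

  The measure \<open>N\<^sup>-\<^sup>k dx\<close> is a mixture of multiples of Lebesgue measure on \<open>(n - k)\<close>-dimensional
  subspaces, namely the common kernels of \<open>k\<close> random covectors with independent Cauchy entries.
  Hence any bound \<open>\<integral>\<^sub>H F \<le> C |B \<inter> H|\<close>, valid for all such subspaces \<open>H\<close> and the Euclidean unit ball \<open>B\<close>,
  integrates to \<open>\<integral> F N\<^sup>-\<^sup>k \<le> C \<integral>\<^sub>B N\<^sup>-\<^sup>k\<close>. With \<open>F = g\<close> on \<open>L\<close>, where \<open>N \<le> 1\<close>, the left-hand side is at
  least \<open>\<integral>\<^sub>L g\<close>, while a layer cake computation bounds \<open>\<integral>\<^sub>B N\<^sup>-\<^sup>k\<close> in terms of \<open>|B|\<close> and \<open>|D|\<close>.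

  The codimension is raised one step at a time: given all but one entry of the covector \<open>\<xi>\<close>, its kernel
  runs through a pencil of hyperplanes, over which Lebesgue measure disintegrates explicitly.
  Uniqueness of Haar measure replaces all determinants.
\<close>

section \<open>Unconditional convex bodies\<close>

lemma scaleR_inverse_mem_of_gauge_of_less:
  fixes L :: "'a::euclidean_space set"
  assumes "convex_body L" and less: "gauge_of L x < t" and "t > 0"
  shows "(1 / t) *\<^sub>R x \<in> L"
proof -
  have "convex L" "0 \<in> interior L" "0 \<in> L"
    using assms(1) interior_subset by (auto simp: convex_body_def)
  then obtain e where cball_e: "e > 0" "cball 0 e \<subseteq> L" by (auto simp: mem_interior_cball)
  let ?S = "{s. s \<ge> 0 \<and> x \<in> (\<lambda>y. s *\<^sub>R y) ` L}"
  have "(e / norm x) *\<^sub>R x \<in> L" using cball_e by (intro subsetD[OF cball_e(2)]) simp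
  moreover have "x = (norm x / e) *\<^sub>R (e / norm x) *\<^sub>R x" using cball_e by simp
  ultimately have "x \<in> (*\<^sub>R) (norm x / e) ` L" by blast
  then have "norm x / e \<in> ?S" using cball_e by simp
  then obtain s where "s \<in> ?S" and s_less: "s < t"
    using cInf_lessD[of ?S] less by (auto simp: gauge_of_def)
  then obtain z where x_scaled: "z \<in> L" "x = s *\<^sub>R z" and "s \<ge> 0" by auto
  have "(s / t) *\<^sub>R z + (1 - s / t) *\<^sub>R 0 \<in> L"
    using \<open>convex L\<close> \<open>0 \<in> L\<close> x_scaled(1) s_less \<open>s \<ge> 0\<close> by (intro convexD) auto
  then show ?thesis using x_scaled(2) by simp
qed

lemma gauge_of_le_1_iff:
  fixes L :: "'a::euclidean_space set"
  assumes "convex_body L"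
  shows "gauge_of L x \<le> 1 \<longleftrightarrow> x \<in> L"
proof
  assume "x \<in> L"
  then have "1 \<in> {s. s \<ge> 0 \<and> x \<in> (\<lambda>y. s *\<^sub>R y) ` L}" by force
  then show "gauge_of L x \<le> 1"
    unfolding gauge_of_def by (rule cInf_lower) (rule bdd_belowI[of _ 0], simp)
next
  assume "gauge_of L x \<le> 1"
  then have scaled: "(1 / (1 + 1 / real (Suc n))) *\<^sub>R x \<in> L" for n
    by (intro scaleR_inverse_mem_of_gauge_of_less[OF assms] add_pos_pos) (auto intro: le_less_trans)
  have limit: "(\<lambda>n. (1 / (1 + 1 / real (Suc n))) *\<^sub>R x) \<longlonglongrightarrow> (1 / (1 + 0)) *\<^sub>R x"
    by (intro tendsto_intros LIMSEQ_Suc[OF lim_1_over_n]) auto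
  have "closed L" using assms by (simp add: convex_body_def compact_imp_closed)
  then have "(1 / (1 + 0)) *\<^sub>R x \<in> L"
    by (rule closed_sequentially[OF _ _ limit]) (rule scaled)
  then show "x \<in> L" by simp
qed

lemma unconditional_mem_of_abs_eq:
  fixes L :: "'a::euclidean_space set"
  assumes body: "convex_body L" "unconditional L" and x_mem: "x \<in> L"
    and abs_eq: "\<And>i. i \<in> Basis \<Longrightarrow> \<bar>y \<bullet> i\<bar> = \<bar>x \<bullet> i\<bar>"
  shows "y \<in> L"
proof -
  define \<delta> where "\<delta> i = (if y \<bullet> i = x \<bullet> i then 1 else -1 :: real)" for i
  have "(\<Sum>i\<in>Basis. (\<delta> i * (x \<bullet> i)) *\<^sub>R i) = (\<Sum>i\<in>Basis. (y \<bullet> i) *\<^sub>R i)"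
  proof (rule sum.cong)
    show "(\<delta> i * (x \<bullet> i)) *\<^sub>R i = (y \<bullet> i) *\<^sub>R i" if "i \<in> Basis" for i
      using abs_eq[OF that] by (auto simp: \<delta>_def abs_if split: if_splits)
  qed simp
  then have "gauge_of L y = gauge_of L x"
    using body(2)[unfolded unconditional_def, rule_format, of \<delta> x]
    by (simp add: \<delta>_def euclidean_representation)
  then show ?thesis using gauge_of_le_1_iff[OF body(1)] x_mem by metis
qed

lemma cbox_symmetric_subset_convex_hull:
  fixes a :: "'a::euclidean_space"
  assumes "\<And>i. i \<in> Basis \<Longrightarrow> a \<bullet> i \<ge> 0"
  shows "cbox (- a) a \<subseteq> convex hull {x. \<forall>i\<in>Basis. \<bar>x \<bullet> i\<bar> = a \<bullet> i}"
proof -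
  define stretch where "stretch x = (\<Sum>i\<in>Basis. ((a \<bullet> i - (- a) \<bullet> i) * (x \<bullet> i)) *\<^sub>R i)" for x :: 'a
  define vertices where "vertices = {x::'a. \<forall>i\<in>Basis. x \<bullet> i = 0 \<or> x \<bullet> i = 1}"
  have "linear stretch"
    unfolding stretch_def[abs_def]
    by (intro linear_compose_sum ballI linearI) (auto simp: inner_add_left algebra_simps)
  have "cbox (- a) a \<noteq> {}" using assms by (auto simp: box_ne_empty)
  then have "cbox (- a) a = (+) (- a) ` stretch ` cbox 0 One"
    unfolding stretch_def[abs_def] by (rule cbox_image_unit_interval)
  also have "\<dots> = convex hull ((+) (- a) ` stretch ` vertices)"
    unfolding unit_interval_convex_hull vertices_def[symmetric]
    by (simp only: convex_hull_linear_image[OF \<open>linear stretch\<close>] convex_hull_translation)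
  also have "\<dots> \<subseteq> convex hull {x. \<forall>i\<in>Basis. \<bar>x \<bullet> i\<bar> = a \<bullet> i}"
    using assms by (intro hull_mono) (auto simp: vertices_def stretch_def inner_diff_left)
  finally show ?thesis .
qed

lemma unconditional_cbox_subset:
  fixes L :: "'a::euclidean_space set"
  assumes "convex_body L" "unconditional L" and "a \<in> L" and "\<And>i. i \<in> Basis \<Longrightarrow> a \<bullet> i \<ge> 0"
  shows "cbox (- a) a \<subseteq> L"
proof -
  have "{x. \<forall>i\<in>Basis. \<bar>x \<bullet> i\<bar> = a \<bullet> i} \<subseteq> L"
    using assms unconditional_mem_of_abs_eq[OF assms(1-3)] by fastforce
  then have "convex hull {x. \<forall>i\<in>Basis. \<bar>x \<bullet> i\<bar> = a \<bullet> i} \<subseteq> L"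
    using assms(1) by (intro hull_minimal) (auto simp: convex_body_def)
  then show ?thesis using cbox_symmetric_subset_convex_hull[OF assms(4)] by blast
qed

lemma convex_body_ex_prod_pos:
  fixes L :: "'a::euclidean_space set"
  assumes "convex_body L"
  obtains x where "x \<in> L" "(\<Prod>i\<in>Basis. \<bar>x \<bullet> i\<bar>) > 0"
proof -
  obtain e where cball_e: "e > 0" "cball 0 e \<subseteq> L"
    using assms by (auto simp: convex_body_def mem_interior_cball)
  define x where "x = (e / real DIM('a)) *\<^sub>R (One::'a)"
  have "norm (One::'a) \<le> (\<Sum>i\<in>Basis. norm (i::'a))" by (rule norm_sum)
  then have "norm (One::'a) \<le> DIM('a)" by simp
  then have "norm x \<le> e / DIM('a) * DIM('a)"
    unfolding x_def norm_scaleR using cball_e by (intro mult_mono) auto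
  then have "x \<in> L" using cball_e by (intro subsetD[OF cball_e(2)]) simp
  moreover have "(\<Prod>i\<in>Basis. \<bar>x \<bullet> i\<bar>) > 0" using cball_e by (auto simp: x_def intro!: prod_pos)
  ultimately show thesis by (rule that)
qed

lemma unconditional_ex_maximal_box:
  fixes L :: "'a::euclidean_space set"
  assumes body: "convex_body L" "unconditional L"
  obtains a where "a \<in> L" "\<And>i. i \<in> Basis \<Longrightarrow> a \<bullet> i > 0"
    "\<And>x. x \<in> L \<Longrightarrow> (\<Prod>i\<in>Basis. \<bar>x \<bullet> i\<bar>) \<le> (\<Prod>i\<in>Basis. a \<bullet> i)"
proof -
  let ?vol = "\<lambda>x::'a. \<Prod>i\<in>Basis. \<bar>x \<bullet> i\<bar>"
  obtain x where prod_pos: "x \<in> L" "?vol x > 0" using convex_body_ex_prod_pos[OF body(1)] .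
  have "continuous_on L ?vol" by (intro continuous_intros)
  then obtain z where maximal: "z \<in> L" "\<And>y. y \<in> L \<Longrightarrow> ?vol y \<le> ?vol z"
    using continuous_attains_sup[of L ?vol] body(1) prod_pos(1) by (auto simp: convex_body_def)
  define a where "a = (\<Sum>i\<in>Basis. \<bar>z \<bullet> i\<bar> *\<^sub>R i)"
  have a_inner: "a \<bullet> i = \<bar>z \<bullet> i\<bar>" if "i \<in> Basis" for i using that by (simp add: a_def)
  show thesis
  proof
    show "a \<in> L" by (rule unconditional_mem_of_abs_eq[OF body maximal(1)]) (simp add: a_inner)
    show "?vol y \<le> (\<Prod>i\<in>Basis. a \<bullet> i)" if "y \<in> L" for y using maximal(2)[OF that] by (simp add: a_inner)
    have "?vol z \<noteq> 0" using prod_pos maximal(2)[OF prod_pos(1)] by linarith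
    then show "a \<bullet> i > 0" if "i \<in> Basis" for i using that by (simp add: a_inner)
  qed
qed

lemma sum_nonpos_of_prod_le_1:
  fixes d :: "'i \<Rightarrow> real"
  assumes le_1: "\<And>t. 0 \<le> t \<Longrightarrow> t \<le> 1 \<Longrightarrow> (\<Prod>i\<in>I. 1 + t * d i) \<le> 1"
  shows "sum d I \<le> 0"
proof (rule ccontr)
  assume "\<not> sum d I \<le> 0"
  have "((\<lambda>t. \<Prod>i\<in>I. 1 + t * d i) has_real_derivative (\<Sum>i\<in>I. d i * (\<Prod>j\<in>I - {i}. 1 + 0 * d j))) (at 0)"
    by (rule has_field_derivative_prod) (auto intro!: derivative_eq_intros)
  then obtain e where increasing: "e > 0" "\<And>h. 0 < h \<Longrightarrow> h < e \<Longrightarrow> 1 < (\<Prod>i\<in>I. 1 + h * d i)"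
    using DERIV_pos_inc_right[of "\<lambda>t. \<Prod>i\<in>I. 1 + t * d i" "sum d I" 0] \<open>\<not> sum d I \<le> 0\<close> by auto
  then have "1 < (\<Prod>i\<in>I. 1 + min 1 (e / 2) * d i)" by simp
  then show False using le_1[of "min 1 (e / 2)"] increasing(1) by simp
qed

lemma sum_ratio_le_of_prod_maximal:
  fixes L :: "'a::euclidean_space set"
  assumes "convex L" "a \<in> L" "x \<in> L"
    and a_pos: "\<And>i. i \<in> Basis \<Longrightarrow> a \<bullet> i > 0" and x_nonneg: "\<And>i. i \<in> Basis \<Longrightarrow> x \<bullet> i \<ge> 0"
    and maximal: "\<And>y. y \<in> L \<Longrightarrow> (\<Prod>i\<in>Basis. \<bar>y \<bullet> i\<bar>) \<le> (\<Prod>i\<in>Basis. a \<bullet> i)"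
  shows "(\<Sum>i\<in>Basis. (x \<bullet> i) / (a \<bullet> i)) \<le> DIM('a)"
proof -
  have "(\<Sum>i\<in>Basis. (x \<bullet> i) / (a \<bullet> i) - 1) \<le> 0"
  proof (rule sum_nonpos_of_prod_le_1)
    fix t :: real assume t_range: "0 \<le> t" "t \<le> 1"
    have coord: "((1 - t) *\<^sub>R a + t *\<^sub>R x) \<bullet> i = (1 + t * ((x \<bullet> i) / (a \<bullet> i) - 1)) * (a \<bullet> i)"
      if "i \<in> Basis" for i
      using a_pos[OF that] by (simp only: inner_add_left inner_scaleR_left) (simp add: field_simps)
    have "(\<Prod>i\<in>Basis. (1 + t * ((x \<bullet> i) / (a \<bullet> i) - 1)) * (a \<bullet> i))
        = (\<Prod>i\<in>Basis. \<bar>((1 - t) *\<^sub>R a + t *\<^sub>R x) \<bullet> i\<bar>)"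
    proof (rule prod.cong)
      fix i :: 'a assume i_Basis: "i \<in> Basis"
      have "((1 - t) *\<^sub>R a + t *\<^sub>R x) \<bullet> i \<ge> 0"
        using a_pos[OF i_Basis] x_nonneg[OF i_Basis] t_range by (simp add: inner_add_left)
      then show "(1 + t * ((x \<bullet> i) / (a \<bullet> i) - 1)) * (a \<bullet> i) = \<bar>((1 - t) *\<^sub>R a + t *\<^sub>R x) \<bullet> i\<bar>"
        using coord[OF i_Basis] by simp
    qed simp
    also have "\<dots> \<le> (\<Prod>i\<in>Basis. a \<bullet> i)"
      using t_range by (intro maximal convexD[OF assms(1-3)]) auto
    finally show "(\<Prod>i\<in>Basis. 1 + t * ((x \<bullet> i) / (a \<bullet> i) - 1)) \<le> 1"
      using prod_pos[of Basis "\<lambda>i. a \<bullet> i"] a_pos by (simp add: prod.distrib)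
  qed
  then show ?thesis by (simp add: sum_subtractf)
qed

section \<open>Weighted cross-polytopes\<close>

definition weighted_l1_norm :: "('a::euclidean_space \<Rightarrow> real) \<Rightarrow> 'a \<Rightarrow> real" where
  "weighted_l1_norm c x = (\<Sum>i\<in>Basis. c i * \<bar>x \<bullet> i\<bar>)"

lemma borel_measurable_weighted_l1_norm [measurable]: "weighted_l1_norm c \<in> borel_measurable borel"
  unfolding weighted_l1_norm_def[abs_def] by measurable

lemma weighted_l1_norm_nonneg:
  "(\<And>i. i \<in> Basis \<Longrightarrow> c i > 0) \<Longrightarrow> weighted_l1_norm c x \<ge> 0"
  unfolding weighted_l1_norm_def by (intro sum_nonneg mult_nonneg_nonneg) (auto intro: less_imp_le)

lemma weighted_l1_norm_pos:
  fixes x :: "'a::euclidean_space"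
  assumes c_pos: "\<And>i. i \<in> Basis \<Longrightarrow> c i > 0" and "x \<noteq> 0"
  shows "weighted_l1_norm c x > 0"
proof -
  obtain i where coord_neq_0: "i \<in> Basis" "x \<bullet> i \<noteq> 0" using \<open>x \<noteq> 0\<close> euclidean_all_zero_iff by blast
  have "0 < c i * \<bar>x \<bullet> i\<bar>" using c_pos[OF coord_neq_0(1)] coord_neq_0(2) by simp
  also have "\<dots> \<le> weighted_l1_norm c x" unfolding weighted_l1_norm_def
    by (rule member_le_sum[OF coord_neq_0(1)]) (auto intro!: mult_nonneg_nonneg less_imp_le[OF c_pos])
  finally show ?thesis .
qed

lemma nn_integral_exp_minus_abs:
  assumes "a > 0"
  shows "(\<integral>\<^sup>+x. ennreal (exp (- (a * \<bar>x :: real\<bar>))) \<partial>lborel) = ennreal (2 / a)"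
proof -
  define expo where "expo x = (if x \<in> {0..} then exp (- a * x) else 0)" for x
  have [measurable]: "expo \<in> borel_measurable borel" unfolding expo_def by measurable
  have "(expo has_integral exp (- a * 0) / a) UNIV"
    unfolding expo_def[abs_def] has_integral_restrict_UNIV
    by (rule has_integral_exp_minus_to_infinity[OF assms])
  then have half_line: "(\<integral>\<^sup>+x. ennreal (expo x) \<partial>lborel) = ennreal (1 / a)"
    by (subst nn_integral_has_integral_lborel) (auto simp: expo_def)
  have "(\<integral>\<^sup>+x. ennreal (exp (- (a * \<bar>x :: real\<bar>))) \<partial>lborel)
      = (\<integral>\<^sup>+x. ennreal (expo x) + ennreal (expo (- x)) \<partial>lborel)"
  proof (rule nn_integral_cong_AE)
    have "AE x in lborel. x \<noteq> (0::real)" by (rule AE_lborel_singleton)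
    then show "AE x in lborel. ennreal (exp (- (a * \<bar>x\<bar>))) = ennreal (expo x) + ennreal (expo (- x))"
      by eventually_elim (auto simp: expo_def)
  qed
  also have "\<dots> = (\<integral>\<^sup>+x. ennreal (expo x) \<partial>lborel) + (\<integral>\<^sup>+x. ennreal (expo (- x)) \<partial>lborel)"
    by (rule nn_integral_add) auto
  also have "(\<integral>\<^sup>+x. ennreal (expo (- x)) \<partial>lborel) = (\<integral>\<^sup>+x. ennreal (expo x) \<partial>lborel)"
    using nn_integral_real_affine[of "\<lambda>x. ennreal (expo x)" "-1" 0] by simp
  finally show ?thesis using assms by (simp add: half_line flip: ennreal_plus)
qed

lemma emeasure_weighted_l1_ball_le:
  fixes c :: "'a::euclidean_space \<Rightarrow> real"
  assumes c_pos: "\<And>i. i \<in> Basis \<Longrightarrow> c i > 0"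
  shows "emeasure lborel {x. weighted_l1_norm c x \<le> r} \<le> ennreal (exp r * (\<Prod>i\<in>Basis. 2 / c i))"
proof -
  have "emeasure lborel {x. weighted_l1_norm c x \<le> r}
      = (\<integral>\<^sup>+x. indicator {x. weighted_l1_norm c x \<le> r} x \<partial>lborel)"
    by simp
  also have "\<dots> \<le> (\<integral>\<^sup>+x. ennreal (exp r) * (\<Prod>i\<in>Basis. ennreal (exp (- (c i * \<bar>x \<bullet> i\<bar>)))) \<partial>lborel)"
  proof (rule nn_integral_mono)
    fix x :: 'a
    have "ennreal (exp r) * (\<Prod>i\<in>Basis. ennreal (exp (- (c i * \<bar>x \<bullet> i\<bar>))))
        = ennreal (exp (r - weighted_l1_norm c x))"
      by (simp add: weighted_l1_norm_def prod_ennreal sum_negf mult_exp_exp flip: exp_sum ennreal_mult)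
    then show "indicator {x. weighted_l1_norm c x \<le> r} x
        \<le> ennreal (exp r) * (\<Prod>i\<in>Basis. ennreal (exp (- (c i * \<bar>x \<bullet> i\<bar>))))"
      by (auto simp: indicator_def)
  qed
  also have "\<dots> = ennreal (exp r) * (\<integral>\<^sup>+x. (\<Prod>i\<in>Basis. ennreal (exp (- (c i * \<bar>x \<bullet> i\<bar>)))) \<partial>lborel)"
    by (rule nn_integral_cmult) measurable
  also have "(\<integral>\<^sup>+x. (\<Prod>i\<in>Basis. ennreal (exp (- (c i * \<bar>x \<bullet> i\<bar>)))) \<partial>lborel)
      = (\<Prod>i\<in>Basis. \<integral>\<^sup>+x. ennreal (exp (- (c i * \<bar>x\<bar>))) \<partial>lborel)"
    by (rule nn_integral_lborel_prod) auto
  also have "\<dots> = ennreal (\<Prod>i\<in>Basis. 2 / c i)"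
    using c_pos by (simp add: nn_integral_exp_minus_abs prod_ennreal less_imp_le)
  finally show ?thesis
    using c_pos by (simp add: ennreal_mult prod_nonneg less_imp_le)
qed

lemma emeasure_weighted_l1_ball_le_power:
  fixes c :: "'a::euclidean_space \<Rightarrow> real"
  assumes "\<And>i. i \<in> Basis \<Longrightarrow> c i > 0" and "r > 0" "s > 0"
  shows "emeasure lborel {x. weighted_l1_norm c x \<le> r}
    \<le> ennreal (exp s * (\<Prod>i\<in>Basis. 2 / c i) * (r / s) ^ DIM('a))"
proof -
  have "weighted_l1_norm (\<lambda>i. s / r * c i) x = s / r * weighted_l1_norm c x" for x
    by (simp add: weighted_l1_norm_def sum_distrib_left mult_ac)
  then have "{x. weighted_l1_norm c x \<le> r} = {x. weighted_l1_norm (\<lambda>i. s / r * c i) x \<le> s}"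
    using assms(2,3) by (simp only:) (simp add: field_simps)
  then have "emeasure lborel {x. weighted_l1_norm c x \<le> r}
      \<le> ennreal (exp s * (\<Prod>i\<in>Basis. 2 / (s / r * c i)))"
    using assms by (simp only:) (intro emeasure_weighted_l1_ball_le, simp)
  also have "(\<Prod>i\<in>Basis. 2 / (s / r * c i)) = (\<Prod>i\<in>Basis. 2 / c i * (r / s))"
    by (simp add: mult.commute)
  also have "\<dots> = (\<Prod>i\<in>Basis. 2 / c i) * (r / s) ^ DIM('a)"
    by (simp only: prod.distrib prod_constant)
  finally show ?thesis by (simp only: mult.assoc)
qed

lemma unconditional_in_weighted_cross_polytope:
  fixes L :: "'a::euclidean_space set"
  assumes body: "convex_body L" "unconditional L"
  obtains c where "\<And>i. i \<in> Basis \<Longrightarrow> c i > 0" "\<And>x. x \<in> L \<Longrightarrow> weighted_l1_norm c x \<le> 1"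
    "\<And>r. r > 0 \<Longrightarrow> emeasure lborel {x. weighted_l1_norm c x \<le> r}
       \<le> ennreal (exp (real DIM('a)) * measure lborel L * r ^ DIM('a))"
proof -
  obtain a where a_mem: "a \<in> L" and a_pos: "\<And>i. i \<in> Basis \<Longrightarrow> a \<bullet> i > 0"
    and maximal: "\<And>x. x \<in> L \<Longrightarrow> (\<Prod>i\<in>Basis. \<bar>x \<bullet> i\<bar>) \<le> (\<Prod>i\<in>Basis. a \<bullet> i)"
    using unconditional_ex_maximal_box[OF body] by blast
  define c where "c i = 1 / (DIM('a) * (a \<bullet> i))" for i
  have c_pos: "c i > 0" if "i \<in> Basis" for i using a_pos[OF that] by (simp add: c_def)
  then show thesis
  proof
    fix x assume "x \<in> L"
    define y where "y = (\<Sum>i\<in>Basis. \<bar>x \<bullet> i\<bar> *\<^sub>R i)"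
    have "y \<in> L" by (rule unconditional_mem_of_abs_eq[OF body \<open>x \<in> L\<close>]) (simp add: y_def)
    then have "(\<Sum>i\<in>Basis. (y \<bullet> i) / (a \<bullet> i)) \<le> DIM('a)"
      using body a_mem a_pos maximal
      by (intro sum_ratio_le_of_prod_maximal[of L]) (auto simp: convex_body_def y_def)
    moreover have "weighted_l1_norm c x = (\<Sum>i\<in>Basis. (y \<bullet> i) / (a \<bullet> i)) / DIM('a)"
      by (simp add: weighted_l1_norm_def c_def y_def sum_divide_distrib mult.commute)
    ultimately show "weighted_l1_norm c x \<le> 1" by simp
  next
    fix r :: real assume "r > 0"
    have "L \<in> fmeasurable lborel" using body(1) by (simp add: convex_body_def fmeasurable_compact)
    moreover have "cbox (- a) a \<subseteq> L"
      using a_mem a_pos by (intro unconditional_cbox_subset[OF body]) (auto intro: less_imp_le)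
    ultimately have "measure lborel (cbox (- a) a) \<le> measure lborel L"
      by (intro measure_mono_fmeasurable) auto
    then have box_le: "(\<Prod>i\<in>Basis. 2 * (a \<bullet> i)) \<le> measure lborel L"
      using a_pos by (subst (asm) content_cbox) (auto intro: less_imp_le)
    have "(\<Prod>i\<in>Basis. 2 / c i) * (r / DIM('a)) ^ DIM('a) = (\<Prod>i\<in>Basis. 2 * (a \<bullet> i)) * r ^ DIM('a)"
      by (simp add: c_def prod.distrib power_divide mult_ac)
    also have "\<dots> \<le> measure lborel L * r ^ DIM('a)"
      using box_le \<open>r > 0\<close> by simp
    finally show "emeasure lborel {x. weighted_l1_norm c x \<le> r}
        \<le> ennreal (exp (DIM('a)) * measure lborel L * r ^ DIM('a))"
      using \<open>r > 0\<close> c_pos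
      by (intro order.trans[OF emeasure_weighted_l1_ball_le_power[of c r "DIM('a)"]] ennreal_leI)
        (auto simp: mult.assoc)
  qed
qed

section \<open>Negative powers of a function with small sublevel sets\<close>

lemma inverse_power_le_layer_cake:
  assumes "0 < k" "0 \<le> y" "0 < (\<rho>::real)"
  shows "ennreal (1 / y ^ k)
    \<le> ennreal (1 / \<rho> ^ k) + (\<integral>\<^sup>+r. ennreal (real k / r ^ Suc k) * indicator {y..\<rho>} r \<partial>lborel)"
proof (cases "0 < y \<and> y \<le> \<rho>")
  case False
  then have "1 / y ^ k \<le> 1 / \<rho> ^ k"
    using assms by (cases "y = 0") (auto simp: frac_le power_mono power_0_left)
  then show ?thesis by (intro add_increasing2 ennreal_leI) simp_all
next
  case True
  have "(\<integral>\<^sup>+r. ennreal (real k / r ^ Suc k) * indicator {y..\<rho>} r \<partial>lborel)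
      = ennreal (- (1 / \<rho> ^ k) - - (1 / y ^ k))"
  proof (rule nn_integral_FTC_Icc)
    fix x assume "x \<in> {y..\<rho>}"
    then have "x > 0" using True by simp
    moreover have "x * x ^ (k - Suc 0) = x ^ k" using \<open>0 < k\<close> by (cases k) auto
    ultimately show "((\<lambda>x. - (1 / x ^ k)) has_real_derivative real k / x ^ Suc k) (at x)"
      by (auto intro!: derivative_eq_intros simp: field_simps)
    show "0 \<le> real k / x ^ Suc k" using \<open>x > 0\<close> by simp
  qed (use True in auto)
  then show ?thesis using True by (simp add: frac_le power_mono flip: ennreal_plus)
qed

lemma layer_cake_density_mult_le:
  assumes "m \<le> ennreal (V * r ^ n)" "V \<ge> 0" "k < n" "r > 0"
  shows "ennreal (real k / r ^ Suc k) * m \<le> ennreal (real k * V * r ^ (n - k - 1))"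
proof -
  have "ennreal (real k / r ^ Suc k) * m \<le> ennreal (real k / r ^ Suc k) * ennreal (V * r ^ n)"
    using assms(1) by (rule mult_left_mono) simp
  also have "\<dots> = ennreal (real k / r ^ Suc k * (V * r ^ n))"
    using assms by (intro ennreal_mult[symmetric]) auto
  also have "real k / r ^ Suc k * (V * r ^ n) = real k * V * r ^ (n - k - 1)"
    using assms power_diff[of r "Suc k" n] by simp
  finally show ?thesis .
qed

lemma (in sigma_finite_measure) nn_integral_layer_cake_le:
  fixes N :: "'a \<Rightarrow> real"
  assumes [measurable]: "N \<in> borel_measurable M"
    and nonneg: "\<And>x. N x \<ge> 0" and "V \<ge> 0" and "k < n" and "\<rho> > 0"
    and level: "\<And>r. r > 0 \<Longrightarrow> emeasure M {x \<in> space M. N x \<le> r} \<le> ennreal (V * r ^ n)"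
  shows "(\<integral>\<^sup>+x. \<integral>\<^sup>+r. ennreal (real k / r ^ Suc k) * indicator {N x..\<rho>} r \<partial>lborel \<partial>M)
    \<le> ennreal (real k * V / real (n - k) * \<rho> ^ (n - k))"
proof -
  interpret pair: pair_sigma_finite M "lborel :: real measure" ..
  let ?w = "\<lambda>r::real. ennreal (real k / r ^ Suc k)"
  have "(\<integral>\<^sup>+x. \<integral>\<^sup>+r. ?w r * indicator {N x..\<rho>} r \<partial>lborel \<partial>M)
      = (\<integral>\<^sup>+r. \<integral>\<^sup>+x. ?w r * indicator {N x..\<rho>} r \<partial>M \<partial>lborel)"
    by (rule pair.Fubini'[symmetric]) (simp add: indicator_def)
  also have "\<dots> = (\<integral>\<^sup>+r. ?w r * indicator {..\<rho>} r * emeasure M {x \<in> space M. N x \<le> r} \<partial>lborel)"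
  proof (rule nn_integral_cong)
    fix r :: real
    have "(\<integral>\<^sup>+x. ?w r * indicator {N x..\<rho>} r \<partial>M)
        = (\<integral>\<^sup>+x. ?w r * indicator {..\<rho>} r * indicator {x \<in> space M. N x \<le> r} x \<partial>M)"
      by (intro nn_integral_cong) (auto simp: indicator_def)
    also have "\<dots> = ?w r * indicator {..\<rho>} r * emeasure M {x \<in> space M. N x \<le> r}"
      by (rule nn_integral_cmult_indicator) measurable
    finally show "(\<integral>\<^sup>+x. ?w r * indicator {N x..\<rho>} r \<partial>M)
        = ?w r * indicator {..\<rho>} r * emeasure M {x \<in> space M. N x \<le> r}" .
  qed
  also have "\<dots> \<le> (\<integral>\<^sup>+r. ennreal (real k * V * r ^ (n - k - 1)) * indicator {0..\<rho>} r \<partial>lborel)"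
  proof (rule nn_integral_mono)
    fix r :: real
    show "?w r * indicator {..\<rho>} r * emeasure M {x \<in> space M. N x \<le> r}
        \<le> ennreal (real k * V * r ^ (n - k - 1)) * indicator {0..\<rho>} r"
    proof (cases "0 < r \<and> r \<le> \<rho>")
      case True
      then show ?thesis
        using layer_cake_density_mult_le[OF level[of r] \<open>V \<ge> 0\<close> \<open>k < n\<close>] by simp
    next
      case False
      moreover have "{x \<in> space M. N x \<le> r} = {}" if "r < 0"
        using nonneg that by (force simp: not_le less_le_trans)
      ultimately show ?thesis
        by (cases "r < 0") (simp_all only: emeasure_empty, auto simp: indicator_def)
    qed
  qed
  also have "\<dots> = ennreal (real k * V / real (n - k) * \<rho> ^ (n - k) - real k * V / real (n - k) * 0 ^ (n - k))"
    using \<open>k < n\<close> \<open>V \<ge> 0\<close> \<open>\<rho> > 0\<close> by (intro nn_integral_FTC_Icc) (auto intro!: derivative_eq_intros)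
  finally show ?thesis using \<open>k < n\<close> by (simp add: power_0_left)
qed

lemma (in sigma_finite_measure) nn_integral_inverse_power_le_cutoff:
  fixes N :: "'a \<Rightarrow> real"
  assumes [measurable]: "N \<in> borel_measurable M" "B \<in> sets M"
    and nonneg: "\<And>x. N x \<ge> 0" and "V \<ge> 0" and "0 < k" "k < n" and "\<rho> > 0"
    and "\<And>r. r > 0 \<Longrightarrow> emeasure M {x \<in> space M. N x \<le> r} \<le> ennreal (V * r ^ n)"
  shows "(\<integral>\<^sup>+x. indicator B x * ennreal (1 / N x ^ k) \<partial>M)
    \<le> emeasure M B * ennreal (1 / \<rho> ^ k) + ennreal (real k * V / real (n - k) * \<rho> ^ (n - k))"
proof -
  let ?cake = "\<lambda>x. \<integral>\<^sup>+r. ennreal (real k / r ^ Suc k) * indicator {N x..\<rho>} r \<partial>lborel"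
  have [measurable]: "(\<lambda>(x, r). ennreal (real k / r ^ Suc k) * indicator {N x..\<rho>} r)
      \<in> borel_measurable (M \<Otimes>\<^sub>M lborel)"
    by (simp add: indicator_def)
  have "(\<integral>\<^sup>+x. indicator B x * ennreal (1 / N x ^ k) \<partial>M)
      \<le> (\<integral>\<^sup>+x. indicator B x * ennreal (1 / \<rho> ^ k) + ?cake x \<partial>M)"
    using inverse_power_le_layer_cake[OF \<open>0 < k\<close> nonneg \<open>\<rho> > 0\<close>]
    by (intro nn_integral_mono) (simp add: indicator_def)
  also have "\<dots> = emeasure M B * ennreal (1 / \<rho> ^ k) + (\<integral>\<^sup>+x. ?cake x \<partial>M)"
    by (subst nn_integral_add) (measurable, simp add: nn_integral_multc)
  also have "(\<integral>\<^sup>+x. ?cake x \<partial>M) \<le> ennreal (real k * V / real (n - k) * \<rho> ^ (n - k))"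
    using assms by (intro nn_integral_layer_cake_le) auto
  finally show ?thesis by (simp add: add_left_mono)
qed

lemma (in sigma_finite_measure) nn_integral_inverse_power_le:
  fixes N :: "'a \<Rightarrow> real"
  assumes "N \<in> borel_measurable M" "B \<in> sets M" "\<And>x. N x \<ge> 0"
    and measure_B: "emeasure M B = ennreal \<beta>" "\<beta> > 0" and V_pos: "V > 0" and k_bounds: "0 < k" "k < n"
    and "\<And>r. r > 0 \<Longrightarrow> emeasure M {x \<in> space M. N x \<le> r} \<le> ennreal (V * r ^ n)"
  shows "(\<integral>\<^sup>+x. indicator B x * ennreal (1 / N x ^ k) \<partial>M)
    \<le> ennreal (real n / (real n - real k) * \<beta> powr ((real n - real k) / real n) * V powr (real k / real n))"
proof -
  define \<rho> where "\<rho> = (\<beta> / V) powr (1 / real n)"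
  have "\<rho> > 0" and powers: "\<rho> ^ n = \<beta> / V" "\<rho> ^ k = (\<beta> / V) powr (real k / real n)"
    using measure_B(2) V_pos k_bounds by (simp_all add: \<rho>_def powr_realpow[symmetric] powr_powr)
  then have "\<rho> ^ (n - k) = \<beta> / V / \<rho> ^ k" using k_bounds by (simp add: power_diff)
  then have "\<beta> * (1 / \<rho> ^ k) + real k * V / real (n - k) * \<rho> ^ (n - k)
      = real n / (real n - real k) * (\<beta> / \<rho> ^ k)"
    using k_bounds V_pos \<open>\<rho> > 0\<close> by (simp add: field_simps of_nat_diff)
  also have "\<beta> / \<rho> ^ k = \<beta> powr (1 - real k / real n) * V powr (real k / real n)"
    using measure_B(2) V_pos by (simp add: powers powr_divide powr_diff)
  also have "1 - real k / real n = (real n - real k) / real n" using k_bounds by (simp add: field_simps)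
  finally have "ennreal \<beta> * ennreal (1 / \<rho> ^ k) + ennreal (real k * V / real (n - k) * \<rho> ^ (n - k))
      = ennreal (real n / (real n - real k) * \<beta> powr ((real n - real k) / real n) * V powr (real k / real n))"
    using measure_B(2) V_pos \<open>\<rho> > 0\<close> by (simp add: mult.assoc flip: ennreal_mult ennreal_plus)
  then show ?thesis
    using nn_integral_inverse_power_le_cutoff[of N B V k n \<rho>] assms \<open>\<rho> > 0\<close> by simp
qed

section \<open>Translation-invariant measures on subspaces\<close>

lemma borel_measurable_linear:
  fixes f :: "'a::euclidean_space \<Rightarrow> 'b::euclidean_space"
  shows "linear f \<Longrightarrow> f \<in> borel_measurable borel"
  by (intro borel_measurable_continuous_onI linear_continuous_on) (simp add: linear_conv_bounded_linear)

lemma UN_cball_nat: "(\<Union>n. cball 0 (real n)) = (UNIV :: 'a::real_normed_vector set)"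
  using real_arch_simple by (auto simp: set_eq_iff)

locale subspace_haar_measure =
  fixes H :: "'a::euclidean_space set" and M :: "'a measure"
  assumes subspace: "subspace H"
    and sets_eq_borel [measurable_cong, simp]: "sets M = sets borel"
    and AE_mem: "AE x in M. x \<in> H"
    and translation_invariant: "h \<in> H \<Longrightarrow> distr M borel ((+) h) = M"
    and emeasure_cball_finite: "emeasure M (cball 0 r) < \<infinity>"
    and nonzero: "emeasure M UNIV \<noteq> 0"
begin

lemma space_eq_UNIV [simp]: "space M = UNIV"
  using sets_eq_imp_space_eq[OF sets_eq_borel] by simp

sublocale sigma_finite_measure M
proof
  show "\<exists>A. countable A \<and> A \<subseteq> sets M \<and> \<Union> A = space M \<and> (\<forall>a\<in>A. emeasure M a \<noteq> \<infinity>)"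
    using emeasure_cball_finite UN_cball_nat
    by (intro exI[of _ "range (\<lambda>n. cball 0 (real n))"]) (auto simp: less_top[symmetric])
qed

lemma nn_integral_translate:
  assumes [measurable]: "F \<in> borel_measurable borel" and "h \<in> H"
  shows "(\<integral>\<^sup>+x. F (h + x) \<partial>M) = (\<integral>\<^sup>+x. F x \<partial>M)"
proof -
  have "(\<integral>\<^sup>+x. F x \<partial>M) = (\<integral>\<^sup>+x. F x \<partial>distr M borel ((+) h))"
    by (simp only: translation_invariant[OF \<open>h \<in> H\<close>])
  also have "\<dots> = (\<integral>\<^sup>+x. F (h + x) \<partial>M)" by (rule nn_integral_distr) auto
  finally show ?thesis ..
qed

lemma ex_cball_emeasure_pos: "\<exists>r. emeasure M (cball 0 r) > 0"
proof (rule ccontr)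
  assume "\<not> ?thesis"
  then have "\<forall>n::nat. cball 0 (real n) \<in> null_sets M" by (auto simp: null_sets_def not_less)
  then have "(\<Union>n. cball 0 (real n)) \<in> null_sets M" by auto
  then show False using nonzero by (auto simp: UN_cball_nat)
qed

lemma AE_linear_neq_0:
  fixes f :: "'a \<Rightarrow> real"
  assumes "linear f" and direction: "h \<in> H" "f h \<noteq> 0"
  shows "AE x in M. f x \<noteq> 0"
proof -
  interpret pair: pair_sigma_finite "lborel :: real measure" M ..
  note [measurable] = borel_measurable_linear[OF \<open>linear f\<close>]
  define hits where "hits x = (indicator {0} (f x) :: ennreal)" for x
  have [measurable]: "hits \<in> borel_measurable borel" unfolding hits_def by measurable
  have "f (t *\<^sub>R h + x) = t * f h + f x" for t x
    using \<open>linear f\<close> by (simp add: linear_add linear_scale)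
  then have "hits (t *\<^sub>R h + x) = indicator {- f x / f h} t" for t x
    using direction(2) by (auto simp: hits_def indicator_def field_simps add_eq_0_iff)
  then have line: "(\<integral>\<^sup>+t. hits (t *\<^sub>R h + x) \<partial>lborel) = 0" for x
    by simp
  have "\<infinity> * (\<integral>\<^sup>+x. hits x \<partial>M) = (\<integral>\<^sup>+t. (\<integral>\<^sup>+x. hits x \<partial>M) \<partial>(lborel :: real measure))"
    by (simp add: mult.commute)
  also have "\<dots> = (\<integral>\<^sup>+t. (\<integral>\<^sup>+x. hits (t *\<^sub>R h + x) \<partial>M) \<partial>lborel)"
    using direction(1) subspace by (simp add: nn_integral_translate subspace_scale)
  also have "\<dots> = (\<integral>\<^sup>+x. (\<integral>\<^sup>+t. hits (t *\<^sub>R h + x) \<partial>lborel) \<partial>M)"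
    by (rule pair.Fubini'[symmetric]) measurable
  also have "\<dots> = 0" by (simp add: line)
  finally have "(\<integral>\<^sup>+x. hits x \<partial>M) = 0" by simp
  then have "AE x in M. hits x = 0" by (simp add: nn_integral_0_iff_AE)
  then show ?thesis by eventually_elim (auto simp: hits_def indicator_def)
qed

end

text \<open>Both sides are the integral of \<open>F x * G (y + x)\<close>: integrating over \<open>y\<close> first removes the shift
  of \<open>G\<close>, while integrating over \<open>x\<close> first, translated by \<open>- y\<close>, moves it to \<open>F\<close>.\<close>
lemma subspace_haar_measure_nn_integral_mult_swap:
  fixes F G :: "'a::euclidean_space \<Rightarrow> ennreal"
  assumes "subspace_haar_measure H M" "subspace_haar_measure H M'"
    and [measurable]: "F \<in> borel_measurable borel" "G \<in> borel_measurable borel"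
  shows "(\<integral>\<^sup>+x. F x \<partial>M) * (\<integral>\<^sup>+y. G y \<partial>M') = (\<integral>\<^sup>+x. G x \<partial>M) * (\<integral>\<^sup>+y. F (- y) \<partial>M')"
proof -
  interpret M: subspace_haar_measure H M by fact
  interpret M': subspace_haar_measure H M' by fact
  interpret pair: pair_sigma_finite M M' ..
  have "(\<integral>\<^sup>+x. F x \<partial>M) * (\<integral>\<^sup>+y. G y \<partial>M') = (\<integral>\<^sup>+x. F x * (\<integral>\<^sup>+y. G y \<partial>M') \<partial>M)"
    by (simp add: nn_integral_multc)
  also have "\<dots> = (\<integral>\<^sup>+x. (\<integral>\<^sup>+y. F x * G (y + x) \<partial>M') \<partial>M)"
    using M.AE_mem M'.nn_integral_translate[of G]
    by (intro nn_integral_cong_AE) (auto simp: nn_integral_cmult add.commute elim: eventually_mono)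
  also have "\<dots> = (\<integral>\<^sup>+y. (\<integral>\<^sup>+x. F x * G (y + x) \<partial>M) \<partial>M')"
    by (rule pair.Fubini'[symmetric]) measurable
  also have "\<dots> = (\<integral>\<^sup>+y. (\<integral>\<^sup>+x. F (x - y) * G x \<partial>M) \<partial>M')"
  proof (rule nn_integral_cong_AE)
    show "AE y in M'. (\<integral>\<^sup>+x. F x * G (y + x) \<partial>M) = (\<integral>\<^sup>+x. F (x - y) * G x \<partial>M)"
      using M'.AE_mem
    proof eventually_elim
      case (elim y)
      then have "- y \<in> H" using M.subspace by (simp add: subspace_neg)
      from M.nn_integral_translate[of "\<lambda>x. F x * G (y + x)", OF _ this] show ?case by simp
    qed
  qed
  also have "\<dots> = (\<integral>\<^sup>+x. (\<integral>\<^sup>+y. F (x - y) * G x \<partial>M') \<partial>M)"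
    by (rule pair.Fubini') measurable
  also have "\<dots> = (\<integral>\<^sup>+x. G x * (\<integral>\<^sup>+y. F (- y) \<partial>M') \<partial>M)"
  proof (rule nn_integral_cong_AE)
    show "AE x in M. (\<integral>\<^sup>+y. F (x - y) * G x \<partial>M') = G x * (\<integral>\<^sup>+y. F (- y) \<partial>M')"
      using M.AE_mem
    proof eventually_elim
      case (elim x)
      from M'.nn_integral_translate[of "\<lambda>y. F (x - y)", OF _ this] show ?case
        by (simp add: nn_integral_multc mult.commute[of "G x"])
    qed
  qed
  also have "\<dots> = (\<integral>\<^sup>+x. G x \<partial>M) * (\<integral>\<^sup>+y. F (- y) \<partial>M')"
    by (rule nn_integral_multc) measurable
  finally show ?thesis .
qed

lemma (in subspace_haar_measure) nn_integral_reflect: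
  assumes [measurable]: "F \<in> borel_measurable borel"
  shows "(\<integral>\<^sup>+x. F (- x) \<partial>M) = (\<integral>\<^sup>+x. F x \<partial>M)"
proof -
  obtain r where ball_pos: "emeasure M (cball 0 r) > 0" using ex_cball_emeasure_pos by blast
  have "(\<integral>\<^sup>+x. F x \<partial>M) * emeasure M (cball 0 r) = emeasure M (cball 0 r) * (\<integral>\<^sup>+x. F (- x) \<partial>M)"
    using subspace_haar_measure_nn_integral_mult_swap[of H M M F "indicator (cball 0 r)"]
    by (simp add: subspace_haar_measure_axioms borel_measurable_indicator)
  then show ?thesis
    using ball_pos emeasure_cball_finite[of r]
    by (auto simp: mult.commute[of _ "emeasure M (cball 0 r)"] ennreal_mult_cancel_left)
qed

theorem subspace_haar_measure_unique:
  assumes "subspace_haar_measure H M" "subspace_haar_measure H M'"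
  obtains \<kappa> where "M' = scale_measure \<kappa> M"
proof -
  interpret M: subspace_haar_measure H M by fact
  interpret M': subspace_haar_measure H M' by fact
  obtain r where ball_pos: "emeasure M (cball 0 r) > 0" using M.ex_cball_emeasure_pos by blast
  let ?\<kappa> = "emeasure M' (cball 0 r) / emeasure M (cball 0 r)"
  have "M' = scale_measure ?\<kappa> M"
  proof (rule measure_eqI)
    fix A assume "A \<in> sets M'"
    then have [measurable]: "A \<in> sets borel" by simp
    have "emeasure M (cball 0 r) * emeasure M' A = emeasure M A * emeasure M' (cball 0 r)"
      using subspace_haar_measure_nn_integral_mult_swap[OF assms, of "indicator (cball 0 r)" "indicator A"]
        M'.nn_integral_reflect[of "indicator (cball 0 r)"]
      by (simp add: borel_measurable_indicator)
    then have "emeasure M' A = emeasure M A * emeasure M' (cball 0 r) / emeasure M (cball 0 r)"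
      using ball_pos M.emeasure_cball_finite[of r]
      by (metis ennreal_mult_divide_eq infinity_ennreal_def less_irrefl mult.commute)
    then show "emeasure M' A = emeasure (scale_measure ?\<kappa> M) A"
      by (simp add: divide_ennreal_def mult_ac)
  qed simp
  then show thesis by (rule that)
qed

corollary subspace_haar_measure_nn_integral_le_transfer:
  assumes "subspace_haar_measure H M" "subspace_haar_measure H M'"
    and [measurable]: "F \<in> borel_measurable borel" "G \<in> borel_measurable borel"
    and integral_le: "(\<integral>\<^sup>+x. F x \<partial>M) \<le> C * (\<integral>\<^sup>+x. G x \<partial>M)"
  shows "(\<integral>\<^sup>+x. F x \<partial>M') \<le> C * (\<integral>\<^sup>+x. G x \<partial>M')"
proof -
  interpret M: subspace_haar_measure H M by fact
  obtain \<kappa> where "M' = scale_measure \<kappa> M"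
    using subspace_haar_measure_unique[OF assms(1,2)] .
  then show ?thesis
    using mult_left_mono[OF integral_le, of \<kappa>] by (simp add: nn_integral_scale_measure mult.left_commute)
qed

lemma subspace_haar_measure_lborel: "subspace_haar_measure UNIV (lborel :: 'a::euclidean_space measure)"
  by unfold_locales
    (simp_all add: lborel_distr_plus emeasure_lborel_cball_finite[unfolded infinity_ennreal_def])

definition line_extension :: "'a::euclidean_space measure \<Rightarrow> 'a \<Rightarrow> 'a measure" where
  "line_extension M a = distr (M \<Otimes>\<^sub>M lborel) borel (\<lambda>(x, s). x + s *\<^sub>R a)"

lemma (in subspace_haar_measure) nn_integral_line_extension:
  assumes [measurable]: "F \<in> borel_measurable borel"
  shows "(\<integral>\<^sup>+x. F x \<partial>line_extension M a) = (\<integral>\<^sup>+x. \<integral>\<^sup>+s. F (x + s *\<^sub>R a) \<partial>lborel \<partial>M)"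
  unfolding line_extension_def
  by (simp add: nn_integral_distr split_beta' lborel.nn_integral_fst[symmetric])

lemma (in subspace_haar_measure) emeasure_line_extension_cball_finite:
  assumes "a \<notin> H"
  shows "emeasure (line_extension M a) (cball 0 r) < \<infinity>"
proof -
  obtain y w where "y \<in> span H" and orth: "\<And>x. x \<in> span H \<Longrightarrow> orthogonal w x" and a_decomp: "a = y + w"
    using orthogonal_subspace_decomp_exists[of H a] by metis
  have "y \<in> H" using \<open>y \<in> span H\<close> span_minimal[OF subset_refl subspace] by blast
  then have "w \<noteq> 0" using \<open>a \<notin> H\<close> a_decomp by auto
  define B where "B = \<bar>r\<bar> / norm w"
  have coords: "norm x \<le> \<bar>r\<bar> + B * norm a \<and> \<bar>s\<bar> \<le> B"
    if "x \<in> H" and norm_le: "norm (x + s *\<^sub>R a) \<le> r" for x s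
  proof -
    have "w \<bullet> (x + s *\<^sub>R a) = s * (w \<bullet> w)"
      using orth[of x] orth[of y] \<open>x \<in> H\<close> \<open>y \<in> H\<close>
      by (simp add: a_decomp orthogonal_def span_base inner_add_right)
    then have "\<bar>s\<bar> * (norm w * norm w) = \<bar>w \<bullet> (x + s *\<^sub>R a)\<bar>"
      by (simp add: abs_mult dot_square_norm power2_eq_square)
    also have "\<dots> \<le> norm w * norm (x + s *\<^sub>R a)" by (rule Cauchy_Schwarz_ineq2)
    also have "\<dots> \<le> norm w * \<bar>r\<bar>" using norm_le by (intro mult_left_mono) auto
    finally have "\<bar>s\<bar> \<le> B" using \<open>w \<noteq> 0\<close> by (simp add: B_def field_simps)
    moreover have "norm x \<le> norm (x + s *\<^sub>R a) + \<bar>s\<bar> * norm a"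
      using norm_triangle_ineq4[of "x + s *\<^sub>R a" "s *\<^sub>R a"] by simp
    moreover have "\<bar>s\<bar> * norm a \<le> B * norm a" using \<open>\<bar>s\<bar> \<le> B\<close> by (rule mult_right_mono) simp
    ultimately show ?thesis using norm_le by linarith
  qed
  have "emeasure (line_extension M a) (cball 0 r)
      = (\<integral>\<^sup>+x. \<integral>\<^sup>+s. indicator (cball 0 r) (x + s *\<^sub>R a) \<partial>lborel \<partial>M)"
    using nn_integral_line_extension[of "indicator (cball 0 r)" a]
    by (simp add: borel_measurable_indicator line_extension_def)
  also have "\<dots> \<le> (\<integral>\<^sup>+x. \<integral>\<^sup>+s. indicator (cball 0 (\<bar>r\<bar> + B * norm a)) x * indicator {- B..B} s \<partial>lborel \<partial>M)"
  proof (intro nn_integral_mono_AE eventually_mono[OF AE_mem] AE_I2)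
    fix x and s :: real
    assume "x \<in> H"
    then show "(indicator (cball 0 r) (x + s *\<^sub>R a) :: ennreal)
        \<le> indicator (cball 0 (\<bar>r\<bar> + B * norm a)) x * indicator {- B..B} s"
      using coords[of x s] by (auto simp: indicator_def abs_le_iff)
  qed
  also have "\<dots> = emeasure M (cball 0 (\<bar>r\<bar> + B * norm a)) * emeasure lborel {- B..B}"
    by (simp add: nn_integral_cmult nn_integral_multc borel_measurable_indicator)
  also have "\<dots> < \<infinity>" using emeasure_cball_finite by (simp add: ennreal_mult_less_top emeasure_lborel_Icc_eq)
  finally show ?thesis .
qed

lemma (in subspace_haar_measure) AE_line_extension_mem:
  "AE x in line_extension M a. x \<in> span (insert a H)"
proof -
  have [measurable]: "span (insert a H) \<in> sets borel"
    by (intro borel_closed closed_subspace subspace_span)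
  interpret pair: pair_sigma_finite M "lborel :: real measure" ..
  have "AE z in M \<Otimes>\<^sub>M lborel. (\<lambda>(x, s). x + s *\<^sub>R a) z \<in> span (insert a H)"
  proof (rule pair.AE_pair_measure)
    show "{z \<in> space (M \<Otimes>\<^sub>M lborel). (\<lambda>(x, s). x + s *\<^sub>R a) z \<in> span (insert a H)} \<in> sets (M \<Otimes>\<^sub>M lborel)"
      by measurable
    show "AE x in M. AE s in lborel. (\<lambda>(x, s). x + s *\<^sub>R a) (x, s) \<in> span (insert a H)"
      using AE_mem by eventually_elim (auto intro: span_add span_scale span_base)
  qed
  then show ?thesis unfolding line_extension_def by (subst AE_distr_iff) auto
qed

lemma (in subspace_haar_measure) distr_line_extension_plus:
  assumes "h \<in> span (insert a H)"
  shows "distr (line_extension M a) borel ((+) h) = line_extension M a"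
proof -
  let ?shift = "\<lambda>(x, s). x + s *\<^sub>R a"
  have [measurable]: "?shift \<in> borel_measurable (M \<Otimes>\<^sub>M lborel)" by measurable
  obtain s\<^sub>0 where "h - s\<^sub>0 *\<^sub>R a \<in> span H" using assms by (auto simp: span_breakdown_eq)
  define h\<^sub>0 where "h\<^sub>0 = h - s\<^sub>0 *\<^sub>R a"
  have "h\<^sub>0 \<in> H"
    using \<open>h - s\<^sub>0 *\<^sub>R a \<in> span H\<close> span_minimal[OF subset_refl subspace] by (auto simp: h\<^sub>0_def)
  have "line_extension M a = distr (distr M borel ((+) h\<^sub>0) \<Otimes>\<^sub>M distr lborel borel ((+) s\<^sub>0)) borel ?shift"
    using \<open>h\<^sub>0 \<in> H\<close> by (simp add: line_extension_def translation_invariant lborel_distr_plus)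
  also have "\<dots> = distr (distr (M \<Otimes>\<^sub>M lborel) (borel \<Otimes>\<^sub>M borel) (\<lambda>(x, s). (h\<^sub>0 + x, s\<^sub>0 + s))) borel ?shift"
    by (subst pair_measure_distr) (auto simp: lborel_distr_plus sigma_finite_lborel)
  also have "\<dots> = distr (M \<Otimes>\<^sub>M lborel) borel (\<lambda>(x, s). h + (x + s *\<^sub>R a))"
    by (subst distr_distr) (auto simp: comp_def split_beta' h\<^sub>0_def algebra_simps)
  also have "\<dots> = distr (line_extension M a) borel ((+) h)"
    unfolding line_extension_def by (subst distr_distr) (auto simp: comp_def split_beta')
  finally show ?thesis ..
qed

lemma (in subspace_haar_measure) subspace_haar_measure_line_extension:
  assumes "a \<notin> H"
  shows "subspace_haar_measure (span (insert a H)) (line_extension M a)"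
proof
  have "emeasure (line_extension M a) UNIV = emeasure M UNIV * \<infinity>"
    using nn_integral_line_extension[of "\<lambda>_. 1" a] by (simp add: line_extension_def mult.commute)
  then show "emeasure (line_extension M a) UNIV \<noteq> 0" using nonzero by (simp add: ennreal_mult_eq_top_iff)
  show "emeasure (line_extension M a) (cball 0 r) < \<infinity>" for r
    using assms by (rule emeasure_line_extension_cball_finite)
qed (simp_all add: line_extension_def[symmetric] AE_line_extension_mem distr_line_extension_plus,
    simp add: line_extension_def)

section \<open>Lebesgue measure on a subspace\<close>

definition subspace_lborel :: "'a::euclidean_space set \<Rightarrow> 'a measure" where
  "subspace_lborel H = (let b = (SOME b. onb_of H b) in
     distr (PiM {..<dim H} (\<lambda>_. lborel)) borel (\<lambda>t. \<Sum>i<dim H. t i *\<^sub>R b i))"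

lemma ex_onb_of:
  fixes H :: "'a::euclidean_space set"
  assumes "subspace H"
  shows "\<exists>b. onb_of H b"
proof -
  obtain B where orthonormal: "pairwise orthogonal B" "\<And>x. x \<in> B \<Longrightarrow> norm x = 1"
    "independent B" "card B = dim H" "span B = H"
    using orthonormal_basis_subspace[OF assms] by metis
  then obtain b where bij: "bij_betw b {..<dim H} B"
    using ex_bij_betw_nat_finite[of B] independent_imp_finite[of B] by (auto simp: atLeast0LessThan)
  have "b i \<bullet> b j = (if i = j then 1 else 0)" if less_dim: "i < dim H" "j < dim H" for i j
  proof (cases "i = j")
    case True
    then show ?thesis using orthonormal(2) bij less_dim by (auto simp: bij_betw_def dot_square_norm)
  next
    case False
    then have "b i \<noteq> b j" using bij less_dim by (auto simp: bij_betw_def inj_on_def)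
    then show ?thesis
      using False bij less_dim orthonormal(1) by (auto simp: bij_betw_def pairwise_def orthogonal_def)
  qed
  then show ?thesis using bij orthonormal(5) by (intro exI[of _ b]) (simp add: onb_of_def bij_betw_def)
qed

lemma onb_of_mem: "onb_of H b \<Longrightarrow> i < dim H \<Longrightarrow> b i \<in> H"
  by (metis imageI lessThan_iff onb_of_def span_base)

lemma norm_onb_of_sum:
  assumes "onb_of H b"
  shows "norm (\<Sum>i<dim H. t i *\<^sub>R b i) = sqrt (\<Sum>i<dim H. (t i)\<^sup>2)"
proof -
  have "(norm (\<Sum>i<dim H. t i *\<^sub>R b i))\<^sup>2 = (\<Sum>i<dim H. (norm (t i *\<^sub>R b i))\<^sup>2)"
    using assms by (intro norm_sum_Pythagorean) (auto simp: pairwise_def orthogonal_def onb_of_def)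
  also have "\<dots> = (\<Sum>i<dim H. (t i)\<^sup>2)"
    using assms by (intro sum.cong) (auto simp: onb_of_def power_mult_distrib simp flip: dot_square_norm)
  finally show ?thesis by (simp add: real_sqrt_unique)
qed

lemma onb_of_expansion:
  assumes onb: "onb_of H b" and "h \<in> H"
  shows "h = (\<Sum>i<dim H. (h \<bullet> b i) *\<^sub>R b i)"
proof -
  let ?d = "h - (\<Sum>i<dim H. (h \<bullet> b i) *\<^sub>R b i)"
  have "h \<in> span (b ` {..<dim H})" using onb \<open>h \<in> H\<close> by (simp add: onb_of_def)
  then have "?d \<in> span (b ` {..<dim H})"
    by (intro span_diff span_sum span_scale) (auto intro: span_base)
  moreover have "orthogonal ?d (b j)" if "j < dim H" for j
  proof -
    have "(\<Sum>i<dim H. (h \<bullet> b i) * (b i \<bullet> b j)) = (\<Sum>i<dim H. if i = j then h \<bullet> b j else 0)"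
      using onb that by (intro sum.cong) (auto simp: onb_of_def)
    then show ?thesis using that by (simp add: orthogonal_def inner_diff_left inner_sum_left)
  qed
  ultimately have "orthogonal ?d ?d" using orthogonal_to_span[of ?d "b ` {..<dim H}"] by blast
  then show ?thesis unfolding orthogonal_self by (simp only: right_minus_eq)
qed

lemma distr_PiM_lborel_plus:
  fixes c :: "'i \<Rightarrow> real"
  assumes "finite I"
  shows "distr (PiM I (\<lambda>_. lborel)) (PiM I (\<lambda>_. lborel)) (\<lambda>t. \<lambda>i\<in>I. c i + t i) = PiM I (\<lambda>_. lborel)"
proof -
  interpret product_sigma_finite "\<lambda>_::'i. lborel :: real measure" ..
  show ?thesis
  proof (rule PiM_eqI[OF assms])
    fix A :: "'i \<Rightarrow> real set"
    assume A_sets: "\<And>i. i \<in> I \<Longrightarrow> A i \<in> sets lborel"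
    then have vimage: "(+) (c i) -` A i \<in> sets lborel" if "i \<in> I" for i
      using measurable_sets[of "(+) (c i)" borel borel "A i"] that by simp
    have "(\<lambda>t. \<lambda>i\<in>I. c i + t i) -` (\<Pi>\<^sub>E i\<in>I. A i) \<inter> space (PiM I (\<lambda>_. lborel)) = (\<Pi>\<^sub>E i\<in>I. (+) (c i) -` A i)"
      by (auto simp: space_PiM PiE_iff extensional_def)
    then have "emeasure (distr (PiM I (\<lambda>_. lborel)) (PiM I (\<lambda>_. lborel)) (\<lambda>t. \<lambda>i\<in>I. c i + t i)) (PiE I A)
        = emeasure (PiM I (\<lambda>_. lborel)) (\<Pi>\<^sub>E i\<in>I. (+) (c i) -` A i)"
      using A_sets assms by (subst emeasure_distr) (auto intro!: sets_PiM_I_finite)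
    also have "\<dots> = (\<Prod>i\<in>I. emeasure lborel ((+) (c i) -` A i))"
      using vimage assms by (intro emeasure_PiM) auto
    also have "\<dots> = (\<Prod>i\<in>I. emeasure lborel (A i))"
    proof (rule prod.cong)
      fix i assume "i \<in> I"
      then have "emeasure (distr lborel borel ((+) (c i))) (A i) = emeasure lborel ((+) (c i) -` A i)"
        using A_sets by (subst emeasure_distr) auto
      then show "emeasure lborel ((+) (c i) -` A i) = emeasure lborel (A i)" by (simp add: lborel_distr_plus)
    qed simp
    finally show "emeasure (distr (PiM I (\<lambda>_. lborel)) (PiM I (\<lambda>_. lborel)) (\<lambda>t. \<lambda>i\<in>I. c i + t i)) (PiE I A)
        = (\<Prod>i\<in>I. emeasure lborel (A i))" .
  qed simp
qed

lemma subspace_lborel_onbE: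
  fixes H :: "'a::euclidean_space set"
  assumes "subspace H"
  obtains b where "onb_of H b"
    "subspace_lborel H = distr (PiM {..<dim H} (\<lambda>_. lborel)) borel (\<lambda>t. \<Sum>i<dim H. t i *\<^sub>R b i)"
  using someI_ex[OF ex_onb_of[OF assms]] by (simp add: subspace_lborel_def)

lemma emeasure_subspace_lborel_cball:
  fixes H :: "'a::euclidean_space set"
  assumes "subspace H" "r > 0"
  shows "emeasure (subspace_lborel H) (cball 0 r) = ennreal (unit_ball_vol (dim H) * r ^ dim H)"
proof -
  obtain b where onb: "onb_of H b" and
    lborel_H: "subspace_lborel H = distr (PiM {..<dim H} (\<lambda>_. lborel)) borel (\<lambda>t. \<Sum>i<dim H. t i *\<^sub>R b i)"
    using subspace_lborel_onbE[OF assms(1)] .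
  have "emeasure (subspace_lborel H) (cball 0 r)
      = emeasure (PiM {..<dim H} (\<lambda>_. lborel))
          ({t. sqrt (\<Sum>i<dim H. (t i)\<^sup>2) \<le> r} \<inter> space (PiM {..<dim H} (\<lambda>_. lborel)))"
    unfolding lborel_H
    by (subst emeasure_distr) (auto intro!: arg_cong[where f = "emeasure _"] simp: norm_onb_of_sum[OF onb])
  also have "\<dots> = ennreal (unit_ball_vol (dim H) * r ^ dim H)"
    using \<open>r > 0\<close> by (subst emeasure_cball_aux) auto
  finally show ?thesis .
qed

lemma distr_subspace_lborel_plus:
  fixes H :: "'a::euclidean_space set"
  assumes "subspace H" "h \<in> H"
  shows "distr (subspace_lborel H) borel ((+) h) = subspace_lborel H"
proof -
  obtain b where onb: "onb_of H b" and
    lborel_H: "subspace_lborel H = distr (PiM {..<dim H} (\<lambda>_. lborel)) borel (\<lambda>t. \<Sum>i<dim H. t i *\<^sub>R b i)"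
    using subspace_lborel_onbE[OF assms(1)] .
  let ?P = "PiM {..<dim H} (\<lambda>_. lborel :: real measure)" and ?shift = "\<lambda>t. \<lambda>i\<in>{..<dim H}. h \<bullet> b i + t i"
  have "subspace_lborel H = distr (distr ?P ?P ?shift) borel (\<lambda>t. \<Sum>i<dim H. t i *\<^sub>R b i)"
    by (simp add: lborel_H distr_PiM_lborel_plus)
  also have "\<dots> = distr ?P borel (\<lambda>t. \<Sum>i<dim H. (h \<bullet> b i + t i) *\<^sub>R b i)"
    by (subst distr_distr) (auto simp: comp_def intro!: distr_cong sum.cong)
  also have "\<dots> = distr ?P borel (\<lambda>t. h + (\<Sum>i<dim H. t i *\<^sub>R b i))"
    by (simp only: scaleR_add_left sum.distrib onb_of_expansion[OF onb \<open>h \<in> H\<close>, symmetric])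
  also have "\<dots> = distr (subspace_lborel H) borel ((+) h)"
    unfolding lborel_H by (subst distr_distr) (auto simp: comp_def)
  finally show ?thesis ..
qed

lemma subspace_haar_measure_subspace_lborel:
  fixes H :: "'a::euclidean_space set"
  assumes "subspace H"
  shows "subspace_haar_measure H (subspace_lborel H)"
proof
  obtain b where onb: "onb_of H b" and
    lborel_H: "subspace_lborel H = distr (PiM {..<dim H} (\<lambda>_. lborel)) borel (\<lambda>t. \<Sum>i<dim H. t i *\<^sub>R b i)"
    using subspace_lborel_onbE[OF assms] .
  show sets: "sets (subspace_lborel H) = sets borel" by (simp add: lborel_H)
  have "(\<Sum>i<dim H. t i *\<^sub>R b i) \<in> H" for t
    using assms onb_of_mem[OF onb] by (intro subspace_sum subspace_scale) auto
  then show "AE x in subspace_lborel H. x \<in> H"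
    unfolding lborel_H using assms by (subst AE_distr_iff) (auto intro!: borel_closed closed_subspace)
  have "0 < emeasure (subspace_lborel H) (cball 0 1)"
    using assms by (simp add: emeasure_subspace_lborel_cball)
  also have "\<dots> \<le> emeasure (subspace_lborel H) UNIV"
    by (rule emeasure_mono) (simp_all add: sets)
  finally show "emeasure (subspace_lborel H) UNIV \<noteq> 0" by simp
  fix r
  have "emeasure (subspace_lborel H) (cball 0 r) \<le> emeasure (subspace_lborel H) (cball 0 (max r 1))"
    by (rule emeasure_mono) (auto simp: sets)
  also have "\<dots> < \<infinity>" using assms by (simp add: emeasure_subspace_lborel_cball)
  finally show "emeasure (subspace_lborel H) (cball 0 r) < \<infinity>" .
qed (use assms distr_subspace_lborel_plus in auto)

section \<open>The Cauchy distribution\<close>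

lemma nn_integral_FTC_UNIV:
  fixes f F :: "real \<Rightarrow> real"
  assumes "\<And>x. (F has_real_derivative f x) (at x)" and "\<And>x. isCont f x" and nonneg: "\<And>x. f x \<ge> 0"
    and "(F \<longlongrightarrow> T) at_top" and "(F \<longlongrightarrow> S) at_bot"
  shows "(\<integral>\<^sup>+x. ennreal (f x) \<partial>lborel) = ennreal (T - S)"
proof -
  have "set_integrable lborel (einterval (-\<infinity>) \<infinity>) f" "(LBINT x=-\<infinity>..\<infinity>. f x) = T - S"
    by (rule interval_integral_FTC_nonneg[where F = F];
        use assms in \<open>simp add: ereal_tendsto_simps1\<close>)+
  then have "integrable lborel f" "integral\<^sup>L lborel f = T - S"
    by (simp_all add: set_integrable_def set_lebesgue_integral_def interval_lebesgue_integral_def)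
  then show ?thesis using nonneg by (simp add: nn_integral_eq_integral)
qed

definition cauchy_density :: "real \<Rightarrow> real \<Rightarrow> real" where
  "cauchy_density \<alpha> u = \<alpha> / (pi * (\<alpha>\<^sup>2 + u\<^sup>2))"

lemma cauchy_density_nonneg: "\<alpha> > 0 \<Longrightarrow> cauchy_density \<alpha> u \<ge> 0"
  by (simp add: cauchy_density_def)

lemma cauchy_density_0: "cauchy_density \<alpha> 0 = 1 / (pi * \<alpha>)"
  by (simp add: cauchy_density_def power2_eq_square)

lemma borel_measurable_cauchy_density [measurable]: "cauchy_density \<alpha> \<in> borel_measurable borel"
  unfolding cauchy_density_def[abs_def] by measurable

lemma isCont_cauchy_density:
  assumes "\<alpha> > 0" "isCont f x"
  shows "isCont (\<lambda>x. cauchy_density \<alpha> (f x)) x"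
proof -
  have "\<alpha>\<^sup>2 + (f x)\<^sup>2 > 0" using \<open>\<alpha> > 0\<close> by (simp add: add_pos_nonneg)
  then show ?thesis unfolding cauchy_density_def using assms by (intro continuous_intros) auto
qed

lemma cauchy_density_scale:
  assumes "\<alpha> > 0" "s \<noteq> 0"
  shows "cauchy_density (\<alpha> * \<bar>s\<bar>) (s * u) = cauchy_density \<alpha> u / \<bar>s\<bar>"
proof -
  have "(\<alpha> * \<bar>s\<bar>)\<^sup>2 + (s * u)\<^sup>2 = \<bar>s\<bar> * \<bar>s\<bar> * (\<alpha>\<^sup>2 + u\<^sup>2)"
    by (simp add: power2_eq_square algebra_simps)
  then show ?thesis using \<open>s \<noteq> 0\<close> by (simp add: cauchy_density_def del: abs_mult_self_eq)
qed

lemma nn_integral_cauchy_density: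
  "(\<integral>\<^sup>+v. ennreal (cauchy_density 1 v) \<partial>lborel) = 1"
proof -
  have "(\<integral>\<^sup>+v. ennreal (cauchy_density 1 v) \<partial>lborel) = ennreal (1 / 2 - - 1 / 2)"
  proof (rule nn_integral_FTC_UNIV)
    show "((\<lambda>v. arctan v / pi) has_real_derivative cauchy_density 1 v) (at v)" for v
      using DERIV_cdivide[OF DERIV_arctan, of pi v] by (simp add: cauchy_density_def divide_simps mult.commute)
    show "((\<lambda>v. arctan v / pi) \<longlongrightarrow> 1 / 2) at_top" by real_asymp
    show "((\<lambda>v. arctan v / pi) \<longlongrightarrow> - 1 / 2) at_bot" by real_asymp
  qed (auto simp: cauchy_density_nonneg intro: isCont_cauchy_density)
  then show ?thesis by simp
qed

lemma DERIV_arctan_affine: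
  fixes \<delta> :: real
  assumes "\<delta> > 0"
  shows "((\<lambda>v. arctan ((v + w) / \<delta>)) has_real_derivative \<delta> / ((v + w)\<^sup>2 + \<delta>\<^sup>2)) (at v)"
  using assms by (auto intro!: derivative_eq_intros simp: power2_eq_square field_simps add_pos_nonneg)

lemma nn_integral_cauchy_density_square:
  assumes "\<alpha> > 0"
  shows "(\<integral>\<^sup>+v. ennreal (cauchy_density \<alpha> v * cauchy_density \<alpha> v) \<partial>lborel)
    = ennreal (cauchy_density (\<alpha> + \<alpha>) 0)"
proof -
  let ?F = "\<lambda>v. (v / (2 * (v\<^sup>2 + \<alpha>\<^sup>2)) + arctan (v / \<alpha>) / (2 * \<alpha>)) / pi\<^sup>2"
  have "(\<integral>\<^sup>+v. ennreal (cauchy_density \<alpha> v * cauchy_density \<alpha> v) \<partial>lborel)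
     = ennreal (1 / (4 * \<alpha> * pi) - - 1 / (4 * \<alpha> * pi))"
  proof (rule nn_integral_FTC_UNIV)
    fix v :: real
    define Q where "Q = v\<^sup>2 + \<alpha>\<^sup>2"
    have "Q > 0" using assms by (simp add: Q_def add_nonneg_pos)
    have rational: "((\<lambda>v. v / (2 * (v\<^sup>2 + \<alpha>\<^sup>2))) has_real_derivative
        (2 * Q - v * (4 * v)) / (2 * Q * (2 * Q))) (at v)"
      using \<open>Q > 0\<close> unfolding Q_def by (auto intro!: derivative_eq_intros)
    have "((\<lambda>v. arctan (v / \<alpha>) / (2 * \<alpha>)) has_real_derivative \<alpha> / Q / (2 * \<alpha>)) (at v)"
      unfolding Q_def by (rule DERIV_cdivide) (use DERIV_arctan_affine[OF assms, of 0 v] in simp)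
    note DERIV_cdivide[OF DERIV_add[OF rational this], of "pi\<^sup>2"]
    also have "(2 * Q - v * (4 * v)) / (2 * Q * (2 * Q)) + \<alpha> / Q / (2 * \<alpha>) = (Q - v\<^sup>2) / Q\<^sup>2"
      using \<open>Q > 0\<close> assms by (simp add: divide_simps) (simp add: power2_eq_square algebra_simps)
    also have "(Q - v\<^sup>2) / Q\<^sup>2 / pi\<^sup>2 = cauchy_density \<alpha> v * cauchy_density \<alpha> v"
      by (simp add: cauchy_density_def Q_def power2_eq_square mult_ac add_ac)
    finally show "(?F has_real_derivative cauchy_density \<alpha> v * cauchy_density \<alpha> v) (at v)" .
    show "(?F \<longlongrightarrow> 1 / (4 * \<alpha> * pi)) at_top" "(?F \<longlongrightarrow> - 1 / (4 * \<alpha> * pi)) at_bot"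
      using assms by (real_asymp simp: power2_eq_square field_simps)+
  qed (use assms in \<open>auto simp: cauchy_density_nonneg intro!: isCont_cauchy_density continuous_intros\<close>)
  also have "1 / (4 * \<alpha> * pi) - - 1 / (4 * \<alpha> * pi) = cauchy_density (\<alpha> + \<alpha>) 0"
    using assms by (simp add: cauchy_density_0 field_simps)
  finally show ?thesis .
qed

lemma DERIV_partial_fractions_quadratic_product:
  fixes \<alpha> \<gamma> u v D :: real
  assumes "\<alpha> > 0" "\<gamma> > 0" and D_eq: "D = (u\<^sup>2 + (\<alpha> + \<gamma>)\<^sup>2) * (u\<^sup>2 + (\<alpha> - \<gamma>)\<^sup>2)" "D \<noteq> 0"
  shows "((\<lambda>v. (u * (ln ((v + u)\<^sup>2 + \<alpha>\<^sup>2) - ln (v\<^sup>2 + \<gamma>\<^sup>2))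
        + (u\<^sup>2 + \<alpha>\<^sup>2 - \<gamma>\<^sup>2) / \<gamma> * arctan (v / \<gamma>) + (u\<^sup>2 + \<gamma>\<^sup>2 - \<alpha>\<^sup>2) / \<alpha> * arctan ((v + u) / \<alpha>)) / D)
      has_real_derivative 1 / (((v + u)\<^sup>2 + \<alpha>\<^sup>2) * (v\<^sup>2 + \<gamma>\<^sup>2))) (at v)"
proof -
  define P Q where "P = v\<^sup>2 + \<gamma>\<^sup>2" and "Q = (v + u)\<^sup>2 + \<alpha>\<^sup>2"
  have pos: "P > 0" "Q > 0" using assms(1,2) by (auto simp: P_def Q_def add_nonneg_pos)
  have "((\<lambda>v. (u * (ln ((v + u)\<^sup>2 + \<alpha>\<^sup>2) - ln (v\<^sup>2 + \<gamma>\<^sup>2))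
        + (u\<^sup>2 + \<alpha>\<^sup>2 - \<gamma>\<^sup>2) / \<gamma> * arctan (v / \<gamma>) + (u\<^sup>2 + \<gamma>\<^sup>2 - \<alpha>\<^sup>2) / \<alpha> * arctan ((v + u) / \<alpha>)) / D)
      has_real_derivative (u * (2 * (v + u) / Q - 2 * v / P)
        + (u\<^sup>2 + \<alpha>\<^sup>2 - \<gamma>\<^sup>2) / \<gamma> * (\<gamma> / P) + (u\<^sup>2 + \<gamma>\<^sup>2 - \<alpha>\<^sup>2) / \<alpha> * (\<alpha> / Q)) / D) (at v)"
    using pos DERIV_arctan_affine[OF \<open>\<gamma> > 0\<close>, of 0] DERIV_arctan_affine[OF \<open>\<alpha> > 0\<close>, of u] unfolding P_def Q_def
    by (intro DERIV_cdivide DERIV_cmult DERIV_add DERIV_diff) (auto intro!: derivative_eq_intros)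
  also have "u * (2 * (v + u) / Q - 2 * v / P) + (u\<^sup>2 + \<alpha>\<^sup>2 - \<gamma>\<^sup>2) / \<gamma> * (\<gamma> / P) + (u\<^sup>2 + \<gamma>\<^sup>2 - \<alpha>\<^sup>2) / \<alpha> * (\<alpha> / Q)
      = ((u\<^sup>2 + \<alpha>\<^sup>2 - \<gamma>\<^sup>2 - 2 * u * v) * Q + (u\<^sup>2 + \<gamma>\<^sup>2 - \<alpha>\<^sup>2 + 2 * u * (v + u)) * P) / (Q * P)"
    using pos assms(1,2) by (simp add: field_simps)
  also have "(u\<^sup>2 + \<alpha>\<^sup>2 - \<gamma>\<^sup>2 - 2 * u * v) * Q + (u\<^sup>2 + \<gamma>\<^sup>2 - \<alpha>\<^sup>2 + 2 * u * (v + u)) * P = D"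
    unfolding D_eq P_def Q_def by algebra
  also have "D / (Q * P) / D = 1 / (Q * P)" using D_eq(2) by simp
  finally show ?thesis by (simp add: P_def Q_def)
qed

lemma cauchy_convolution_distinct:
  assumes "\<alpha> > 0" "\<gamma> > 0" and distinct: "u \<noteq> 0 \<or> \<alpha> \<noteq> \<gamma>"
  shows "(\<integral>\<^sup>+v. ennreal (cauchy_density \<alpha> (u + v) * cauchy_density \<gamma> v) \<partial>lborel)
    = ennreal (cauchy_density (\<alpha> + \<gamma>) u)"
proof -
  define D where "D = (u\<^sup>2 + (\<alpha> + \<gamma>)\<^sup>2) * (u\<^sup>2 + (\<alpha> - \<gamma>)\<^sup>2)"
  define B C where "B = (u\<^sup>2 + \<alpha>\<^sup>2 - \<gamma>\<^sup>2) / \<gamma>" and "C = (u\<^sup>2 + \<gamma>\<^sup>2 - \<alpha>\<^sup>2) / \<alpha>"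
  have factor_pos: "u\<^sup>2 + (\<alpha> - \<gamma>)\<^sup>2 > 0" using distinct by (auto simp: sum_power2_gt_zero_iff)
  moreover have "u\<^sup>2 + (\<alpha> + \<gamma>)\<^sup>2 > 0" using assms(1,2) by (simp add: add_nonneg_pos)
  ultimately have "D > 0" by (simp add: D_def)
  let ?f = "\<lambda>v. (u * (ln ((v + u)\<^sup>2 + \<alpha>\<^sup>2) - ln (v\<^sup>2 + \<gamma>\<^sup>2)) + B * arctan (v / \<gamma>) + C * arctan ((v + u) / \<alpha>)) / D"
  let ?T = "\<alpha> * \<gamma> / pi\<^sup>2 * ((u * 0 + B * (pi / 2) + C * (pi / 2)) / D)"
  let ?S = "\<alpha> * \<gamma> / pi\<^sup>2 * ((u * 0 + B * (- (pi / 2)) + C * (- (pi / 2))) / D)"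
  have "(\<integral>\<^sup>+v. ennreal (cauchy_density \<alpha> (u + v) * cauchy_density \<gamma> v) \<partial>lborel) = ennreal (?T - ?S)"
  proof (rule nn_integral_FTC_UNIV)
    fix v :: real
    have "((\<lambda>v. \<alpha> * \<gamma> / pi\<^sup>2 * ?f v) has_real_derivative
        \<alpha> * \<gamma> / pi\<^sup>2 * (1 / (((v + u)\<^sup>2 + \<alpha>\<^sup>2) * (v\<^sup>2 + \<gamma>\<^sup>2)))) (at v)"
      using \<open>D > 0\<close> assms(1,2) unfolding B_def C_def
      by (intro DERIV_cmult DERIV_partial_fractions_quadratic_product) (auto simp: D_def)
    then show "((\<lambda>v. \<alpha> * \<gamma> / pi\<^sup>2 * ?f v) has_real_derivative
        cauchy_density \<alpha> (u + v) * cauchy_density \<gamma> v) (at v)"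
      by (simp add: cauchy_density_def power2_eq_square[of pi] mult_ac add_ac)
  next
    have logs: "((\<lambda>v. ln ((v + u)\<^sup>2 + \<alpha>\<^sup>2) - ln (v\<^sup>2 + \<gamma>\<^sup>2)) \<longlongrightarrow> 0) at_top"
      "((\<lambda>v. ln ((v + u)\<^sup>2 + \<alpha>\<^sup>2) - ln (v\<^sup>2 + \<gamma>\<^sup>2)) \<longlongrightarrow> 0) at_bot"
      by real_asymp+
    have arctans: "((\<lambda>v. arctan ((v + w) / \<delta>)) \<longlongrightarrow> pi / 2) at_top"
      "((\<lambda>v. arctan ((v + w) / \<delta>)) \<longlongrightarrow> - (pi / 2)) at_bot" if "\<delta> > 0" for w \<delta> :: real
      using that by real_asymp+
    show "((\<lambda>v. \<alpha> * \<gamma> / pi\<^sup>2 * ?f v) \<longlongrightarrow> ?T) at_top" "((\<lambda>v. \<alpha> * \<gamma> / pi\<^sup>2 * ?f v) \<longlongrightarrow> ?S) at_bot"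
      using arctans[OF \<open>\<gamma> > 0\<close>, of 0] arctans[OF \<open>\<alpha> > 0\<close>, of u] \<open>D > 0\<close>
      by (intro tendsto_mult tendsto_divide tendsto_add tendsto_const logs; simp)+
  qed (use assms in \<open>auto simp: cauchy_density_nonneg intro!: isCont_cauchy_density continuous_intros\<close>)
  also have "?T - ?S = \<alpha> * \<gamma> * (B + C) / (pi * D)"
    using \<open>D > 0\<close> by (simp add: field_simps power2_eq_square)
  also have "\<alpha> * \<gamma> * (B + C) = \<alpha> * (u\<^sup>2 + \<alpha>\<^sup>2 - \<gamma>\<^sup>2) + \<gamma> * (u\<^sup>2 + \<gamma>\<^sup>2 - \<alpha>\<^sup>2)"
    using assms(1,2) by (simp add: B_def C_def field_simps)
  also have "\<dots> = (\<alpha> + \<gamma>) * (u\<^sup>2 + (\<alpha> - \<gamma>)\<^sup>2)" by algebra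
  also have "\<dots> / (pi * D) = cauchy_density (\<alpha> + \<gamma>) u"
    using factor_pos by (simp add: cauchy_density_def D_def add.commute del: sum_power2_eq_zero_iff)
  finally show ?thesis .
qed

lemma cauchy_convolution:
  assumes "\<alpha> > 0" "\<gamma> > 0"
  shows "(\<integral>\<^sup>+v. ennreal (cauchy_density \<alpha> (u + v) * cauchy_density \<gamma> v) \<partial>lborel)
    = ennreal (cauchy_density (\<alpha> + \<gamma>) u)"
proof (cases "u = 0 \<and> \<alpha> = \<gamma>")
  case True
  then show ?thesis using nn_integral_cauchy_density_square[OF \<open>\<alpha> > 0\<close>] by simp
next
  case False
  then show ?thesis using assms by (intro cauchy_convolution_distinct) auto
qed

definition std_cauchy :: "real measure" where
  "std_cauchy = density lborel (\<lambda>x. ennreal (cauchy_density 1 x))"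

lemma sets_std_cauchy [simp, measurable_cong]: "sets std_cauchy = sets borel"
  by (simp add: std_cauchy_def)

lemma emeasure_std_cauchy_UNIV: "emeasure std_cauchy UNIV = 1"
  by (simp add: std_cauchy_def emeasure_density nn_integral_cauchy_density)

interpretation std_cauchy: finite_measure std_cauchy
  by (rule finite_measureI) (simp add: emeasure_std_cauchy_UNIV sets_eq_imp_space_eq[OF sets_std_cauchy])

interpretation std_cauchy_product: product_sigma_finite "\<lambda>_::'i. std_cauchy" ..

lemma nn_integral_std_cauchy_cauchy_density:
  assumes "\<alpha> > 0"
  shows "(\<integral>\<^sup>+y. ennreal (cauchy_density \<alpha> (u + b * y)) \<partial>std_cauchy) = ennreal (cauchy_density (\<alpha> + \<bar>b\<bar>) u)"
proof (cases "b = 0")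
  case True
  then show ?thesis
    using emeasure_std_cauchy_UNIV by (simp add: sets_eq_imp_space_eq[OF sets_std_cauchy])
next
  case False
  have "ennreal (cauchy_density (\<alpha> + \<bar>b\<bar>) u)
      = (\<integral>\<^sup>+v. ennreal (cauchy_density \<alpha> (u + v) * cauchy_density \<bar>b\<bar> v) \<partial>lborel)"
    using assms False by (intro cauchy_convolution[symmetric]) auto
  also have "\<dots> = ennreal \<bar>b\<bar>
      * (\<integral>\<^sup>+y. ennreal (cauchy_density \<alpha> (u + (0 + b * y)) * cauchy_density \<bar>b\<bar> (0 + b * y)) \<partial>lborel)"
    using False by (intro nn_integral_real_affine) auto
  also have "\<dots> = (\<integral>\<^sup>+y. ennreal \<bar>b\<bar>
      * ennreal (cauchy_density \<alpha> (u + (0 + b * y)) * cauchy_density \<bar>b\<bar> (0 + b * y)) \<partial>lborel)"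
    by (rule nn_integral_cmult[symmetric]) measurable
  also have "\<dots> = (\<integral>\<^sup>+y. ennreal (cauchy_density 1 y) * ennreal (cauchy_density \<alpha> (u + b * y)) \<partial>lborel)"
    using assms False cauchy_density_scale[of 1 b]
    by (intro nn_integral_cong) (simp add: cauchy_density_nonneg mult.commute flip: ennreal_mult)
  also have "\<dots> = (\<integral>\<^sup>+y. ennreal (cauchy_density \<alpha> (u + b * y)) \<partial>std_cauchy)"
    unfolding std_cauchy_def by (rule nn_integral_density[symmetric]) measurable
  finally show ?thesis ..
qed

lemma nn_integral_PiM_std_cauchy_cauchy_density:
  fixes x :: "'i \<Rightarrow> real"
  assumes "finite I" "\<alpha> > 0"
  shows "(\<integral>\<^sup>+\<zeta>. ennreal (cauchy_density \<alpha> (u + (\<Sum>j\<in>I. x j * \<zeta> j))) \<partial>PiM I (\<lambda>_. std_cauchy))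
    = ennreal (cauchy_density (\<alpha> + (\<Sum>j\<in>I. \<bar>x j\<bar>)) u)"
  using assms
proof (induction I arbitrary: \<alpha> rule: finite_induct)
  case empty
  then show ?case by (simp add: PiM_empty)
next
  case (insert i I)
  have split: "u + (\<Sum>j\<in>insert i I. x j * (\<zeta>(i := y)) j) = u + (\<Sum>j\<in>I. x j * \<zeta> j) + x i * y" for \<zeta> y
    using insert.hyps by (simp add: add.commute) (intro sum.cong; auto)
  have "(\<integral>\<^sup>+\<zeta>. ennreal (cauchy_density \<alpha> (u + (\<Sum>j\<in>insert i I. x j * \<zeta> j))) \<partial>PiM (insert i I) (\<lambda>_. std_cauchy))
      = (\<integral>\<^sup>+\<zeta>. \<integral>\<^sup>+y. ennreal (cauchy_density \<alpha> (u + (\<Sum>j\<in>I. x j * \<zeta> j) + x i * y))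
          \<partial>std_cauchy \<partial>PiM I (\<lambda>_. std_cauchy))"
    by (subst std_cauchy_product.product_nn_integral_insert[OF insert.hyps(1,2)])
      (simp_all only: split, measurable)
  also have "\<dots> = ennreal (cauchy_density (\<alpha> + \<bar>x i\<bar> + (\<Sum>j\<in>I. \<bar>x j\<bar>)) u)"
    using insert.prems by (simp add: nn_integral_std_cauchy_cauchy_density insert.IH add_pos_nonneg)
  finally show ?case using insert.hyps by (simp add: add.assoc)
qed

text \<open>A Cauchy variable \<open>Z\<close> of scale \<open>S\<close> has no atom at \<open>0\<close>: the density at \<open>0\<close> of the sum of \<open>Z\<close> and
  an independent Cauchy variable of scale \<open>\<alpha>\<close> is at least \<open>P (Z = 0) / (\<pi> \<alpha>)\<close> and equals
  \<open>1 / (\<pi> (\<alpha> + S))\<close>; let \<open>\<alpha> \<rightarrow> 0\<close>.\<close>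
lemma AE_PiM_std_cauchy_linear_form_neq_0:
  fixes x :: "'i \<Rightarrow> real"
  assumes "finite I" "j \<in> I" "x j \<noteq> 0"
  shows "AE \<zeta> in PiM I (\<lambda>_. std_cauchy). (\<Sum>j\<in>I. x j * \<zeta> j) \<noteq> 0"
proof -
  let ?P = "PiM I (\<lambda>_. std_cauchy)"
  define S where "S = (\<Sum>j\<in>I. \<bar>x j\<bar>)"
  define hits where "hits \<zeta> = (indicator {0} (\<Sum>j\<in>I. x j * \<zeta> j) :: ennreal)" for \<zeta>
  have [measurable]: "hits \<in> borel_measurable ?P" unfolding hits_def by measurable
  have "\<bar>x j\<bar> \<le> S" unfolding S_def using assms by (intro member_le_sum) auto
  then have "S > 0" using \<open>x j \<noteq> 0\<close> by linarith
  have "(\<integral>\<^sup>+\<zeta>. hits \<zeta> \<partial>?P) \<le> 0 + ennreal \<epsilon>" if "\<epsilon> > 0" for \<epsilon>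
  proof -
    define \<alpha> where "\<alpha> = \<epsilon> * S"
    have "\<alpha> > 0" using \<open>\<epsilon> > 0\<close> \<open>S > 0\<close> by (simp add: \<alpha>_def)
    have "(\<integral>\<^sup>+\<zeta>. hits \<zeta> \<partial>?P)
        \<le> (\<integral>\<^sup>+\<zeta>. ennreal (pi * \<alpha>) * ennreal (cauchy_density \<alpha> (0 + (\<Sum>j\<in>I. x j * \<zeta> j))) \<partial>?P)"
      using \<open>\<alpha> > 0\<close>
      by (intro nn_integral_mono) (auto simp: hits_def indicator_def cauchy_density_0 simp flip: ennreal_mult)
    also have "\<dots> = ennreal (pi * \<alpha>) * ennreal (cauchy_density (\<alpha> + S) 0)"
      using assms \<open>\<alpha> > 0\<close> unfolding S_def
      by (subst nn_integral_cmult) (measurable, simp only: nn_integral_PiM_std_cauchy_cauchy_density)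
    also have "\<dots> = ennreal (\<alpha> / (\<alpha> + S))"
      using \<open>\<alpha> > 0\<close> \<open>S > 0\<close> by (simp add: cauchy_density_0 flip: ennreal_mult)
    also have "\<dots> \<le> ennreal \<epsilon>"
      using \<open>\<alpha> > 0\<close> \<open>S > 0\<close> \<open>\<epsilon> > 0\<close>
      by (intro ennreal_leI) (simp add: pos_divide_le_eq add_pos_pos distrib_left \<alpha>_def[symmetric])
    finally show ?thesis by simp
  qed
  then have "(\<integral>\<^sup>+\<zeta>. hits \<zeta> \<partial>?P) \<le> 0" by (rule ennreal_le_epsilon)
  then have "AE \<zeta> in ?P. hits \<zeta> = 0" by (simp add: nn_integral_0_iff_AE)
  then show ?thesis by eventually_elim (auto simp: hits_def)
qed

definition weighted_covector :: "('a::euclidean_space \<Rightarrow> real) \<Rightarrow> 'a \<Rightarrow> ('a \<Rightarrow> real) \<Rightarrow> 'a \<Rightarrow> real" where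
  "weighted_covector c i \<zeta> x = (\<Sum>j\<in>Basis - {i}. c j * (x \<bullet> j) * \<zeta> j)"

lemma linear_weighted_covector: "linear (weighted_covector c i \<zeta>)"
  unfolding weighted_covector_def[abs_def]
  by (intro linearI; simp add: inner_add_left sum.distrib sum_distrib_left algebra_simps)

lemma borel_measurable_weighted_covector [measurable (raw)]:
  assumes \<zeta>_measurable: "\<zeta> \<in> measurable M (PiM (Basis - {i}) (\<lambda>_. std_cauchy))"
    and [measurable]: "x \<in> borel_measurable M"
  shows "(\<lambda>\<omega>. weighted_covector c i (\<zeta> \<omega>) (x \<omega>)) \<in> borel_measurable M"
proof -
  have [measurable]: "(\<lambda>\<omega>. \<zeta> \<omega> j) \<in> borel_measurable M" if "j \<in> Basis - {i}" for j
    using measurable_compose[OF \<zeta>_measurable measurable_component_singleton[OF that]]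
    by (simp cong: measurable_cong_sets)
  show ?thesis unfolding weighted_covector_def by measurable
qed

lemma inverse_weighted_l1_norm_eq_nn_integral:
  fixes c :: "'a::euclidean_space \<Rightarrow> real"
  assumes c_pos: "\<And>j. j \<in> Basis \<Longrightarrow> c j > 0" and "i \<in> Basis" "x \<bullet> i \<noteq> 0"
  shows "ennreal (1 / weighted_l1_norm c x) =
    (\<integral>\<^sup>+\<zeta>. ennreal (pi * cauchy_density (c i) (weighted_covector c i \<zeta> x / (x \<bullet> i))) * ennreal (1 / \<bar>x \<bullet> i\<bar>)
      \<partial>PiM (Basis - {i}) (\<lambda>_. std_cauchy))"
proof -
  let ?P = "PiM (Basis - {i}) (\<lambda>_. std_cauchy)"
  let ?\<xi> = "\<lambda>\<zeta>. weighted_covector c i \<zeta> x"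
  have scale_pos: "c i * \<bar>x \<bullet> i\<bar> > 0" using assms by simp
  have "weighted_l1_norm c x = c i * \<bar>x \<bullet> i\<bar> + (\<Sum>j\<in>Basis - {i}. \<bar>c j * (x \<bullet> j)\<bar>)"
    unfolding weighted_l1_norm_def using c_pos \<open>i \<in> Basis\<close>
    by (subst sum.remove[of Basis i]) (auto simp: abs_mult abs_of_pos)
  then have "ennreal (cauchy_density (weighted_l1_norm c x) 0)
      = (\<integral>\<^sup>+\<zeta>. ennreal (cauchy_density (c i * \<bar>x \<bullet> i\<bar>) (0 + ?\<xi> \<zeta>)) \<partial>?P)"
    using scale_pos unfolding weighted_covector_def
    by (subst nn_integral_PiM_std_cauchy_cauchy_density) auto
  also have "\<dots> = (\<integral>\<^sup>+\<zeta>. ennreal (cauchy_density (c i) (?\<xi> \<zeta> / (x \<bullet> i)) / \<bar>x \<bullet> i\<bar>) \<partial>?P)"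
    using cauchy_density_scale[of "c i" "x \<bullet> i" "?\<xi> _ / (x \<bullet> i)"] assms by simp
  finally have density_at_0: "ennreal (cauchy_density (weighted_l1_norm c x) 0)
      = (\<integral>\<^sup>+\<zeta>. ennreal (cauchy_density (c i) (?\<xi> \<zeta> / (x \<bullet> i)) / \<bar>x \<bullet> i\<bar>) \<partial>?P)" .
  have "weighted_l1_norm c x > 0" using assms by (intro weighted_l1_norm_pos) auto
  then have "ennreal (1 / weighted_l1_norm c x)
      = ennreal pi * ennreal (cauchy_density (weighted_l1_norm c x) 0)"
    by (simp add: cauchy_density_0 flip: ennreal_mult)
  also have "\<dots> = (\<integral>\<^sup>+\<zeta>. ennreal pi * ennreal (cauchy_density (c i) (?\<xi> \<zeta> / (x \<bullet> i)) / \<bar>x \<bullet> i\<bar>) \<partial>?P)"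
    unfolding density_at_0 by (rule nn_integral_cmult[symmetric]) measurable
  finally show ?thesis
    using c_pos \<open>i \<in> Basis\<close> by (simp add: cauchy_density_nonneg flip: ennreal_mult)
qed

section \<open>Pencils of hyperplanes\<close>

text \<open>In the coordinates \<open>z + \<tau> a + s b\<close> of the extended space the ratio \<open>\<xi> / \<eta>\<close> is \<open>\<tau> / s\<close>; the
  substitution \<open>\<tau> = s \<rho>\<close> absorbs the weight \<open>1 / \<bar>\<eta>\<bar>\<close> and turns \<open>z + \<tau> a + s b\<close> into \<open>z + s (\<rho> a + b)\<close>.\<close>
lemma (in subspace_haar_measure) nn_integral_pencil:
  fixes \<xi> \<eta> :: "'a \<Rightarrow> real" and F :: "'a \<Rightarrow> ennreal" and \<phi> :: "real \<Rightarrow> ennreal"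
  assumes "linear \<xi>" "linear \<eta>"
    and vanish: "\<And>z. z \<in> H \<Longrightarrow> \<xi> z = 0" "\<And>z. z \<in> H \<Longrightarrow> \<eta> z = 0"
    and dual: "\<xi> a = 1" "\<eta> a = 0" "\<xi> b = 0" "\<eta> b = 1"
    and [measurable]: "F \<in> borel_measurable borel" "\<phi> \<in> borel_measurable borel"
  shows "(\<integral>\<^sup>+x. F x * (\<phi> (\<xi> x / \<eta> x) * ennreal (1 / \<bar>\<eta> x\<bar>)) \<partial>line_extension (line_extension M a) b)
    = (\<integral>\<^sup>+\<rho>. \<phi> \<rho> * (\<integral>\<^sup>+x. F x \<partial>line_extension M (\<rho> *\<^sub>R a + b)) \<partial>lborel)"
proof -
  note [measurable] = borel_measurable_linear[OF \<open>linear \<xi>\<close>] borel_measurable_linear[OF \<open>linear \<eta>\<close>]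
  have "a \<notin> H" using vanish(1)[of a] dual(1) by auto
  then interpret plane: subspace_haar_measure "span (insert a H)" "line_extension M a"
    by (rule subspace_haar_measure_line_extension)
  interpret pair: pair_sigma_finite M "lborel :: real measure" ..
  let ?weight = "\<lambda>x. \<phi> (\<xi> x / \<eta> x) * ennreal (1 / \<bar>\<eta> x\<bar>)"
  let ?point = "\<lambda>z \<tau> s. z + \<tau> *\<^sub>R a + s *\<^sub>R b"
  have substitution: "(\<integral>\<^sup>+\<tau>. F (?point z \<tau> s) * ?weight (?point z \<tau> s) \<partial>lborel)
      = (\<integral>\<^sup>+\<rho>. \<phi> \<rho> * F (z + s *\<^sub>R (\<rho> *\<^sub>R a + b)) \<partial>lborel)"
    if "z \<in> H" "s \<noteq> 0" for z s
  proof -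
    have coords: "\<xi> (?point z \<tau> s) = \<tau>" "\<eta> (?point z \<tau> s) = s" for \<tau>
      using assms(1,2) vanish[OF \<open>z \<in> H\<close>] dual by (simp_all add: linear_add linear_scale)
    have "(\<integral>\<^sup>+\<tau>. F (?point z \<tau> s) * ?weight (?point z \<tau> s) \<partial>lborel)
        = ennreal \<bar>s\<bar>
          * (\<integral>\<^sup>+\<rho>. F (?point z (0 + s * \<rho>) s) * (\<phi> ((0 + s * \<rho>) / s) * ennreal (1 / \<bar>s\<bar>)) \<partial>lborel)"
      unfolding coords by (rule nn_integral_real_affine) (use \<open>s \<noteq> 0\<close> in auto)
    also have "\<dots> = (\<integral>\<^sup>+\<rho>. ennreal \<bar>s\<bar>
        * (F (?point z (0 + s * \<rho>) s) * (\<phi> ((0 + s * \<rho>) / s) * ennreal (1 / \<bar>s\<bar>))) \<partial>lborel)"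
      by (rule nn_integral_cmult[symmetric]) measurable
    also have "\<dots> = (\<integral>\<^sup>+\<rho>. (ennreal \<bar>s\<bar> * ennreal (1 / \<bar>s\<bar>)) * (\<phi> \<rho> * F (z + s *\<^sub>R (\<rho> *\<^sub>R a + b))) \<partial>lborel)"
      using \<open>s \<noteq> 0\<close> by (intro nn_integral_cong) (simp add: scaleR_add_right add.assoc mult_ac)
    finally show ?thesis using \<open>s \<noteq> 0\<close> by (simp flip: ennreal_mult)
  qed
  have "(\<integral>\<^sup>+x. F x * ?weight x \<partial>line_extension (line_extension M a) b)
      = (\<integral>\<^sup>+z. \<integral>\<^sup>+\<tau>. \<integral>\<^sup>+s. F (?point z \<tau> s) * ?weight (?point z \<tau> s) \<partial>lborel \<partial>lborel \<partial>M)"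
    by (simp add: plane.nn_integral_line_extension nn_integral_line_extension)
  also have "\<dots> = (\<integral>\<^sup>+z. \<integral>\<^sup>+s. \<integral>\<^sup>+\<tau>. F (?point z \<tau> s) * ?weight (?point z \<tau> s) \<partial>lborel \<partial>lborel \<partial>M)"
    by (intro nn_integral_cong lborel_pair.Fubini') measurable
  also have "\<dots> = (\<integral>\<^sup>+z. \<integral>\<^sup>+s. \<integral>\<^sup>+\<rho>. \<phi> \<rho> * F (z + s *\<^sub>R (\<rho> *\<^sub>R a + b)) \<partial>lborel \<partial>lborel \<partial>M)"
    by (intro nn_integral_cong_AE eventually_mono[OF AE_mem]
        eventually_mono[OF AE_lborel_singleton[of 0]] substitution)
  also have "\<dots> = (\<integral>\<^sup>+z. \<integral>\<^sup>+\<rho>. \<integral>\<^sup>+s. \<phi> \<rho> * F (z + s *\<^sub>R (\<rho> *\<^sub>R a + b)) \<partial>lborel \<partial>lborel \<partial>M)"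
    by (intro nn_integral_cong lborel_pair.Fubini') measurable
  also have "\<dots> = (\<integral>\<^sup>+\<rho>. \<integral>\<^sup>+z. \<integral>\<^sup>+s. \<phi> \<rho> * F (z + s *\<^sub>R (\<rho> *\<^sub>R a + b)) \<partial>lborel \<partial>M \<partial>lborel)"
    by (rule pair.Fubini'[symmetric]) measurable
  finally show ?thesis
    by (simp add: nn_integral_line_extension nn_integral_cmult)
qed

lemma subspace_eq_span_kernel_pencil:
  fixes \<xi> \<eta> :: "'a::euclidean_space \<Rightarrow> real"
  assumes subspace_E: "subspace E" and "linear \<xi>" "linear \<eta>" and "a \<in> E" "b \<in> E"
    and dual: "\<xi> a = 1" "\<eta> a = 0" "\<xi> b = 0" "\<eta> b = 1"
    and K_eq: "K = {z \<in> E. \<xi> z = 0 \<and> \<eta> z = 0}"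
  shows "subspace K" "span (insert b (span (insert a K))) = E" "b \<notin> span (insert a K)"
proof -
  interpret \<xi>: linear \<xi> by fact
  interpret \<eta>: linear \<eta> by fact
  show "subspace K"
    using subspace_E by (auto simp: K_eq subspace_def \<xi>.add \<eta>.add \<xi>.scaleR \<eta>.scaleR)
  have "x \<in> span (insert b (span (insert a K)))" if "x \<in> E" for x
  proof -
    let ?z = "x - \<xi> x *\<^sub>R a - \<eta> x *\<^sub>R b"
    have "?z \<in> K"
      using assms that
      by (simp add: K_eq subspace_diff subspace_scale \<xi>.diff \<eta>.diff \<xi>.scaleR \<eta>.scaleR)
    then have "?z + \<xi> x *\<^sub>R a + \<eta> x *\<^sub>R b \<in> span (insert b (span (insert a K)))"
      by (intro span_add span_scale) (auto intro: span_base)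
    then show ?thesis by simp
  qed
  moreover have "span (insert a K) \<subseteq> E"
    using assms by (intro span_minimal) (auto simp: K_eq)
  then have "span (insert b (span (insert a K))) \<subseteq> E"
    using assms by (intro span_minimal) auto
  ultimately show "span (insert b (span (insert a K))) = E" by blast
  have "span (insert a K) \<subseteq> {x. \<eta> x = 0}"
    using dual by (intro span_minimal) (auto simp: K_eq subspace_def \<eta>.add \<eta>.scaleR)
  then show "b \<notin> span (insert a K)" using dual by auto
qed

lemma Grass_pencil_coordinates:
  fixes \<xi> \<eta> :: "'a::euclidean_space \<Rightarrow> real"
  assumes E_Grass: "E \<in> Grass (Suc m)" and "linear \<xi>" "linear \<eta>"
    and x_witness: "x \<in> E" "\<eta> x \<noteq> 0" and y_witness: "y \<in> E" "\<eta> y = 0" "\<xi> y \<noteq> 0"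
  obtains a b K where "\<xi> a = 1" "\<eta> a = 0" "\<xi> b = 0" "\<eta> b = 1"
    "subspace K" "Suc (dim K) = m" "\<And>z. z \<in> K \<Longrightarrow> \<xi> z = 0" "\<And>z. z \<in> K \<Longrightarrow> \<eta> z = 0"
    "span (insert b (span (insert a K))) = E" "b \<notin> span (insert a K)"
proof -
  interpret \<xi>: linear \<xi> by fact
  interpret \<eta>: linear \<eta> by fact
  have "subspace E" "dim E = Suc m" using E_Grass by (auto simp: Grass_def)
  define a where "a = (1 / \<xi> y) *\<^sub>R y"
  define b where "b = (1 / \<eta> x) *\<^sub>R x - (\<xi> x / \<eta> x) *\<^sub>R a"
  define K where "K = {z \<in> E. \<xi> z = 0 \<and> \<eta> z = 0}"
  have "a \<in> E" "b \<in> E"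
    using \<open>subspace E\<close> x_witness y_witness by (simp_all add: a_def b_def subspace_scale subspace_diff)
  moreover have dual: "\<xi> a = 1" "\<eta> a = 0" "\<xi> b = 0" "\<eta> b = 1"
    using x_witness y_witness by (simp_all add: a_def b_def \<xi>.diff \<eta>.diff \<xi>.scaleR \<eta>.scaleR)
  ultimately have "subspace K" and span_K: "span (insert b (span (insert a K))) = E"
    and b_notin: "b \<notin> span (insert a K)"
    using subspace_eq_span_kernel_pencil[OF \<open>subspace E\<close> assms(2,3) _ _ dual K_def] by auto
  have "a \<notin> span K"
    using dual span_minimal[OF subset_refl \<open>subspace K\<close>] by (auto simp: K_def)
  then have "dim (span (insert b (span (insert a K)))) = Suc (Suc (dim K))"
    using b_notin by (simp only: dim_span dim_insert span_span) simp
  then have "Suc (dim K) = m" using \<open>dim E = Suc m\<close> unfolding span_K by simp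
  then show thesis
    by (rule that[OF dual \<open>subspace K\<close> _ _ _ span_K b_notin]) (simp_all add: K_def)
qed

lemma (in subspace_haar_measure) nn_integral_pencil_le:
  fixes \<xi> \<eta> :: "'a \<Rightarrow> real" and F G :: "'a \<Rightarrow> ennreal" and \<phi> :: "real \<Rightarrow> ennreal"
  assumes linear: "linear \<xi>" "linear \<eta>"
    and vanish: "\<And>z. z \<in> H \<Longrightarrow> \<xi> z = 0" "\<And>z. z \<in> H \<Longrightarrow> \<eta> z = 0"
    and dual: "\<xi> a = 1" "\<eta> a = 0" "\<xi> b = 0" "\<eta> b = 1"
    and [measurable]: "F \<in> borel_measurable borel" "G \<in> borel_measurable borel"
      "\<phi> \<in> borel_measurable borel"
    and hyperplane_le: "\<And>h. h \<notin> H \<Longrightarrow>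
      (\<integral>\<^sup>+x. F x \<partial>line_extension M h) \<le> C * (\<integral>\<^sup>+x. G x \<partial>line_extension M h)"
  shows "(\<integral>\<^sup>+x. F x * (\<phi> (\<xi> x / \<eta> x) * ennreal (1 / \<bar>\<eta> x\<bar>)) \<partial>line_extension (line_extension M a) b)
    \<le> C * (\<integral>\<^sup>+x. G x * (\<phi> (\<xi> x / \<eta> x) * ennreal (1 / \<bar>\<eta> x\<bar>)) \<partial>line_extension (line_extension M a) b)"
proof -
  have "\<eta> (\<rho> *\<^sub>R a + b) = 1" for \<rho>
    using linear dual by (simp add: linear_add linear_scale)
  then have "\<rho> *\<^sub>R a + b \<notin> H" for \<rho> using vanish(2) by force
  then have "(\<integral>\<^sup>+\<rho>. \<phi> \<rho> * (\<integral>\<^sup>+x. F x \<partial>line_extension M (\<rho> *\<^sub>R a + b)) \<partial>lborel)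
      \<le> (\<integral>\<^sup>+\<rho>. \<phi> \<rho> * (C * (\<integral>\<^sup>+x. G x \<partial>line_extension M (\<rho> *\<^sub>R a + b))) \<partial>lborel)"
    by (intro nn_integral_mono mult_left_mono hyperplane_le) auto
  also have "\<dots> = C * (\<integral>\<^sup>+\<rho>. \<phi> \<rho> * (\<integral>\<^sup>+x. G x \<partial>line_extension M (\<rho> *\<^sub>R a + b)) \<partial>lborel)"
    by (simp add: nn_integral_line_extension nn_integral_cmult mult.left_commute[of _ C])
  finally show ?thesis
    by (simp only: nn_integral_pencil[OF linear vanish dual] assms(9-11))
qed

proposition subspace_lborel_pencil_le:
  fixes \<xi> \<eta> :: "'a::euclidean_space \<Rightarrow> real" and F G :: "'a \<Rightarrow> ennreal" and \<phi> :: "real \<Rightarrow> ennreal"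
  assumes E_Grass: "E \<in> Grass (Suc m)" and linear: "linear \<xi>" "linear \<eta>"
    and x_witness: "x \<in> E" "\<eta> x \<noteq> 0" and y_witness: "y \<in> E" "\<eta> y = 0" "\<xi> y \<noteq> 0"
    and [measurable]: "F \<in> borel_measurable borel" "G \<in> borel_measurable borel"
      "\<phi> \<in> borel_measurable borel"
    and sections_le: "\<And>H. H \<in> Grass m \<Longrightarrow>
      (\<integral>\<^sup>+x. F x \<partial>subspace_lborel H) \<le> C * (\<integral>\<^sup>+x. G x \<partial>subspace_lborel H)"
  shows "(\<integral>\<^sup>+x. F x * (\<phi> (\<xi> x / \<eta> x) * ennreal (1 / \<bar>\<eta> x\<bar>)) \<partial>subspace_lborel E)
    \<le> C * (\<integral>\<^sup>+x. G x * (\<phi> (\<xi> x / \<eta> x) * ennreal (1 / \<bar>\<eta> x\<bar>)) \<partial>subspace_lborel E)"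
proof -
  note [measurable] = linear[THEN borel_measurable_linear]
  obtain a b K where dual: "\<xi> a = 1" "\<eta> a = 0" "\<xi> b = 0" "\<eta> b = 1"
    and "subspace K" and dim_K: "Suc (dim K) = m"
    and vanish: "\<And>z. z \<in> K \<Longrightarrow> \<xi> z = 0" "\<And>z. z \<in> K \<Longrightarrow> \<eta> z = 0"
    and span_K: "span (insert b (span (insert a K))) = E" and b_notin: "b \<notin> span (insert a K)"
    using Grass_pencil_coordinates[OF E_Grass linear x_witness y_witness] by metis
  interpret K: subspace_haar_measure K "subspace_lborel K"
    using \<open>subspace K\<close> by (rule subspace_haar_measure_subspace_lborel)
  have "a \<notin> K" using dual vanish by force
  then interpret plane: subspace_haar_measure "span (insert a K)" "line_extension (subspace_lborel K) a"
    by (rule K.subspace_haar_measure_line_extension)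
  have "(\<integral>\<^sup>+x. F x \<partial>line_extension (subspace_lborel K) h)
      \<le> C * (\<integral>\<^sup>+x. G x \<partial>line_extension (subspace_lborel K) h)"
    if "h \<notin> K" for h
  proof (rule subspace_haar_measure_nn_integral_le_transfer)
    have "h \<notin> span K" using that span_minimal[OF subset_refl \<open>subspace K\<close>] by blast
    then have "span (insert h K) \<in> Grass m" using dim_K by (simp add: Grass_def dim_insert)
    then show "(\<integral>\<^sup>+x. F x \<partial>subspace_lborel (span (insert h K)))
        \<le> C * (\<integral>\<^sup>+x. G x \<partial>subspace_lborel (span (insert h K)))"
      by (rule sections_le)
    show "subspace_haar_measure (span (insert h K)) (subspace_lborel (span (insert h K)))"
      by (intro subspace_haar_measure_subspace_lborel subspace_span)
    show "subspace_haar_measure (span (insert h K)) (line_extension (subspace_lborel K) h)"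
      using that by (rule K.subspace_haar_measure_line_extension)
  qed measurable
  note pencil_le = K.nn_integral_pencil_le[OF linear vanish dual assms(9-11) this]
  have "subspace_haar_measure E (line_extension (line_extension (subspace_lborel K) a) b)"
    using plane.subspace_haar_measure_line_extension[OF b_notin] unfolding span_K .
  moreover have "subspace_haar_measure E (subspace_lborel E)"
    using E_Grass by (intro subspace_haar_measure_subspace_lborel) (simp add: Grass_def)
  ultimately show ?thesis
    by (rule subspace_haar_measure_nn_integral_le_transfer[OF _ _ _ _ pencil_le]) measurable
qed

section \<open>Integration against negative powers of a weighted \<open>l\<^sub>1\<close>-norm\<close>

lemma (in subspace_haar_measure) nn_integral_inverse_weighted_l1_norm:
  fixes c :: "'a \<Rightarrow> real" and F :: "'a \<Rightarrow> ennreal"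
  assumes c_pos: "\<And>j. j \<in> Basis \<Longrightarrow> c j > 0" and i_Basis: "i \<in> Basis" and x_witness: "x \<in> H" "x \<bullet> i \<noteq> 0"
    and [measurable]: "F \<in> borel_measurable borel"
  shows "(\<integral>\<^sup>+x. F x * ennreal (1 / weighted_l1_norm c x) \<partial>M)
    = (\<integral>\<^sup>+\<zeta>. \<integral>\<^sup>+x. F x * (ennreal (pi * cauchy_density (c i) (weighted_covector c i \<zeta> x / (x \<bullet> i)))
        * ennreal (1 / \<bar>x \<bullet> i\<bar>)) \<partial>M \<partial>PiM (Basis - {i}) (\<lambda>_. std_cauchy))"
proof -
  let ?P = "PiM (Basis - {i}) (\<lambda>_. std_cauchy)"
  let ?w = "\<lambda>\<zeta> x. ennreal (pi * cauchy_density (c i) (weighted_covector c i \<zeta> x / (x \<bullet> i)))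
    * ennreal (1 / \<bar>x \<bullet> i\<bar>)"
  have "sigma_finite_measure ?P" by (intro std_cauchy_product.sigma_finite) simp
  then interpret pair: pair_sigma_finite M ?P by (intro pair_sigma_finite.intro sigma_finite_measure_axioms)
  have "linear (\<lambda>x. x \<bullet> i)" by (intro linearI) (simp_all add: inner_add_left)
  then have AE_neq_0: "AE x in M. x \<bullet> i \<noteq> 0" using x_witness by (rule AE_linear_neq_0)
  have "(\<integral>\<^sup>+x. F x * ennreal (1 / weighted_l1_norm c x) \<partial>M) = (\<integral>\<^sup>+x. \<integral>\<^sup>+\<zeta>. F x * ?w \<zeta> x \<partial>?P \<partial>M)"
  proof (intro nn_integral_cong_AE eventually_mono[OF AE_neq_0])
    fix x assume "x \<bullet> i \<noteq> 0"
    note inverse_weighted_l1_norm_eq_nn_integral[OF c_pos i_Basis this]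
    then show "F x * ennreal (1 / weighted_l1_norm c x) = (\<integral>\<^sup>+\<zeta>. F x * ?w \<zeta> x \<partial>?P)"
      by (simp only:) (rule nn_integral_cmult[symmetric], measurable)
  qed
  also have "\<dots> = (\<integral>\<^sup>+\<zeta>. \<integral>\<^sup>+x. F x * ?w \<zeta> x \<partial>M \<partial>?P)"
    by (rule pair.Fubini'[symmetric]) measurable
  finally show ?thesis .
qed

lemma Grass_ex_coordinate_vectors:
  fixes E :: "'a::euclidean_space set"
  assumes "E \<in> Grass m" "m \<ge> 2"
  obtains i j x y where "i \<in> Basis" "x \<in> E" "x \<bullet> i \<noteq> 0" "j \<in> Basis - {i}" "y \<in> E" "y \<bullet> i = 0" "y \<bullet> j \<noteq> 0"
proof -
  have "subspace E" "dim E \<ge> 2" using assms by (auto simp: Grass_def)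
  have "\<not> E \<subseteq> {0}" using \<open>dim E \<ge> 2\<close> by (auto simp flip: dim_eq_0)
  then obtain x i where x_coord: "x \<in> E" "i \<in> Basis" "x \<bullet> i \<noteq> 0"
    using euclidean_all_zero_iff by (metis insertI1 subsetI)
  have "\<not> E \<subseteq> span {x}" using dim_subset[of E "span {x}"] dim_le_card'[of "{x}"] \<open>dim E \<ge> 2\<close> by auto
  then obtain z where z_indep: "z \<in> E" "z \<notin> span {x}" by blast
  define y where "y = z - (z \<bullet> i / (x \<bullet> i)) *\<^sub>R x"
  have "y \<noteq> 0" using z_indep(2) by (auto simp: y_def span_singleton)
  then obtain j where "j \<in> Basis" "y \<bullet> j \<noteq> 0" using euclidean_all_zero_iff by blast
  moreover have "y \<in> E" "y \<bullet> i = 0"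
    using \<open>subspace E\<close> x_coord z_indep(1) by (simp_all add: y_def subspace_diff subspace_scale inner_diff_left)
  ultimately show thesis using that x_coord by (metis DiffI singletonD)
qed

lemma subspace_lborel_inverse_weighted_l1_norm_le:
  fixes F G :: "'a::euclidean_space \<Rightarrow> ennreal" and c :: "'a \<Rightarrow> real"
  assumes E_Grass: "E \<in> Grass (Suc m)" and "m \<ge> 1" and c_pos: "\<And>j. j \<in> Basis \<Longrightarrow> c j > 0"
    and [measurable]: "F \<in> borel_measurable borel" "G \<in> borel_measurable borel"
    and sections_le: "\<And>H. H \<in> Grass m \<Longrightarrow>
      (\<integral>\<^sup>+x. F x \<partial>subspace_lborel H) \<le> C * (\<integral>\<^sup>+x. G x \<partial>subspace_lborel H)"
  shows "(\<integral>\<^sup>+x. F x * ennreal (1 / weighted_l1_norm c x) \<partial>subspace_lborel E)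
    \<le> C * (\<integral>\<^sup>+x. G x * ennreal (1 / weighted_l1_norm c x) \<partial>subspace_lborel E)"
proof -
  interpret E: subspace_haar_measure E "subspace_lborel E"
    using E_Grass by (intro subspace_haar_measure_subspace_lborel) (simp add: Grass_def)
  obtain i j x y where i_Basis: "i \<in> Basis" and x_witness: "x \<in> E" "x \<bullet> i \<noteq> 0"
    and j_Basis: "j \<in> Basis - {i}" and y_witness: "y \<in> E" "y \<bullet> i = 0" "y \<bullet> j \<noteq> 0"
    using Grass_ex_coordinate_vectors[OF E_Grass] \<open>m \<ge> 1\<close>
    by (metis One_nat_def Suc_le_mono numeral_2_eq_2)
  let ?P = "PiM (Basis - {i}) (\<lambda>_. std_cauchy)"
  let ?w = "\<lambda>\<zeta> x. ennreal (pi * cauchy_density (c i) (weighted_covector c i \<zeta> x / (x \<bullet> i)))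
    * ennreal (1 / \<bar>x \<bullet> i\<bar>)"
  have "linear (\<lambda>x. x \<bullet> i)" by (intro linearI) (simp_all add: inner_add_left)
  note pencil_le = subspace_lborel_pencil_le[OF E_Grass linear_weighted_covector this x_witness y_witness(1,2)]
  have "c j * (y \<bullet> j) \<noteq> 0" using j_Basis y_witness c_pos[of j] by simp
  then have AE_neq_0: "AE \<zeta> in ?P. weighted_covector c i \<zeta> y \<noteq> 0"
    using j_Basis unfolding weighted_covector_def by (intro AE_PiM_std_cauchy_linear_form_neq_0) auto
  have "(\<integral>\<^sup>+\<zeta>. \<integral>\<^sup>+x. F x * ?w \<zeta> x \<partial>subspace_lborel E \<partial>?P)
      \<le> (\<integral>\<^sup>+\<zeta>. C * (\<integral>\<^sup>+x. G x * ?w \<zeta> x \<partial>subspace_lborel E) \<partial>?P)"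
  proof (intro nn_integral_mono_AE eventually_mono[OF AE_neq_0])
    fix \<zeta> assume "weighted_covector c i \<zeta> y \<noteq> 0"
    then show "(\<integral>\<^sup>+x. F x * ?w \<zeta> x \<partial>subspace_lborel E) \<le> C * (\<integral>\<^sup>+x. G x * ?w \<zeta> x \<partial>subspace_lborel E)"
      by (rule pencil_le[where \<phi> = "\<lambda>u. ennreal (pi * cauchy_density (c i) u)"]) (measurable, rule sections_le)
  qed
  also have "\<dots> = C * (\<integral>\<^sup>+\<zeta>. \<integral>\<^sup>+x. G x * ?w \<zeta> x \<partial>subspace_lborel E \<partial>?P)"
    by (rule nn_integral_cmult) measurable
  finally show ?thesis
    by (simp only: E.nn_integral_inverse_weighted_l1_norm[OF c_pos i_Basis x_witness] assms(4,5))
qed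

theorem subspace_lborel_inverse_power_weighted_l1_norm_le:
  fixes F G :: "'a::euclidean_space \<Rightarrow> ennreal" and c :: "'a \<Rightarrow> real"
  assumes "E \<in> Grass (m + k)" and "m \<ge> 1" and c_pos: "\<And>j. j \<in> Basis \<Longrightarrow> c j > 0"
    and [measurable]: "F \<in> borel_measurable borel" "G \<in> borel_measurable borel"
    and sections_le: "\<And>H. H \<in> Grass m \<Longrightarrow>
      (\<integral>\<^sup>+x. F x \<partial>subspace_lborel H) \<le> C * (\<integral>\<^sup>+x. G x \<partial>subspace_lborel H)"
  shows "(\<integral>\<^sup>+x. F x * ennreal (1 / weighted_l1_norm c x ^ k) \<partial>subspace_lborel E)
    \<le> C * (\<integral>\<^sup>+x. G x * ennreal (1 / weighted_l1_norm c x ^ k) \<partial>subspace_lborel E)"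
  using \<open>E \<in> Grass (m + k)\<close>
proof (induction k arbitrary: E)
  case 0
  then show ?case using sections_le by simp
next
  case (Suc k)
  have power_Suc: "\<Phi> x * ennreal (1 / weighted_l1_norm c x ^ Suc k)
      = \<Phi> x * ennreal (1 / weighted_l1_norm c x ^ k) * ennreal (1 / weighted_l1_norm c x)" for \<Phi> x
  proof -
    have "weighted_l1_norm c x \<ge> 0" using c_pos by (rule weighted_l1_norm_nonneg)
    then have "ennreal (1 / weighted_l1_norm c x ^ Suc k)
        = ennreal (1 / weighted_l1_norm c x ^ k) * ennreal (1 / weighted_l1_norm c x)"
      by (simp add: mult.commute flip: ennreal_mult)
    then show ?thesis by (simp only: mult.assoc)
  qed
  show ?case
    unfolding power_Suc using Suc.prems \<open>m \<ge> 1\<close>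
    by (intro subspace_lborel_inverse_weighted_l1_norm_le[of _ "m + k"] c_pos Suc.IH) auto
qed

section \<open>The slicing inequality\<close>

lemma (in subspace_haar_measure) integrable_indicator_continuous_on_compact:
  fixes g :: "'a \<Rightarrow> real"
  assumes "compact L" "continuous_on L g"
  shows "integrable M (\<lambda>x. indicator L x * g x)"
proof -
  have [measurable]: "L \<in> sets borel" using \<open>compact L\<close> by (simp add: borel_closed compact_imp_closed)
  have "bounded (g ` L)" using assms by (intro compact_imp_bounded compact_continuous_image)
  then obtain A where "\<And>x. x \<in> L \<Longrightarrow> norm (g x) \<le> A" by (auto simp: bounded_iff)
  moreover obtain R where "L \<subseteq> cball 0 R"
    using compact_imp_bounded[OF \<open>compact L\<close>] by (auto simp: bounded_iff subset_iff)
  then have "emeasure M L \<le> emeasure M (cball 0 R)" by (intro emeasure_mono) auto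
  then have "emeasure M L < \<infinity>" using emeasure_cball_finite[of R] by (rule le_less_trans)
  ultimately show ?thesis
    using borel_measurable_continuous_on_indicator[OF \<open>L \<in> sets borel\<close> assms(2)]
    by (intro integrableI_bounded_set[of L _ _ A]) (auto simp: indicator_def)
qed

lemma section_integral_eq_integral_subspace_lborel:
  fixes L H :: "'a::euclidean_space set"
  assumes "(\<lambda>x. indicator L x * g x) \<in> borel_measurable borel"
  shows "section_integral g L H = (\<integral>x. indicator L x * g x \<partial>subspace_lborel H)"
  using assms by (simp add: section_integral_def subspace_lborel_def Let_def integral_distr)

lemma nn_integral_subspace_lborel_eq_section_integral:
  fixes L H :: "'a::euclidean_space set"
  assumes "subspace H" "compact L" "continuous_on L g" and nonneg: "\<And>x. x \<in> L \<Longrightarrow> g x \<ge> 0"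
  shows "(\<integral>\<^sup>+x. ennreal (indicator L x * g x) \<partial>subspace_lborel H) = ennreal (section_integral g L H)"
proof -
  interpret subspace_haar_measure H "subspace_lborel H"
    using \<open>subspace H\<close> by (rule subspace_haar_measure_subspace_lborel)
  have integrable: "integrable (subspace_lborel H) (\<lambda>x. indicator L x * g x)"
    using assms(2,3) by (rule integrable_indicator_continuous_on_compact)
  then have "(\<integral>\<^sup>+x. ennreal (indicator L x * g x) \<partial>subspace_lborel H)
      = ennreal (\<integral>x. indicator L x * g x \<partial>subspace_lborel H)"
    using nonneg by (intro nn_integral_eq_integral) (auto simp: indicator_def)
  also have "(\<integral>x. indicator L x * g x \<partial>subspace_lborel H) = section_integral g L H"
    using borel_measurable_integrable[OF integrable]
    by (intro section_integral_eq_integral_subspace_lborel[symmetric]) simp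
  finally show ?thesis .
qed

lemma section_integral_nonneg:
  fixes L H :: "'a::euclidean_space set"
  assumes "\<And>x. x \<in> L \<Longrightarrow> g x \<ge> 0"
  shows "section_integral g L H \<ge> 0"
  unfolding section_integral_def Let_def
  by (rule integral_nonneg_AE) (use assms in \<open>auto simp: indicator_def\<close>)

lemma bdd_above_section_integral:
  fixes L :: "'a::euclidean_space set"
  assumes "compact L" "continuous_on L g" and "\<And>x. x \<in> L \<Longrightarrow> g x \<ge> 0"
  shows "bdd_above (section_integral g L ` Grass m)"
proof -
  obtain A where g_le: "A > 0" "\<And>x. x \<in> L \<Longrightarrow> g x \<le> A"
    using compact_imp_bounded[OF compact_continuous_image[OF assms(2,1)]]
    by (auto simp: bounded_pos abs_le_iff)
  obtain R where L_subset: "R > 0" "L \<subseteq> cball 0 R"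
    using compact_imp_bounded[OF \<open>compact L\<close>] by (auto simp: bounded_pos subset_iff)
  have "section_integral g L H \<le> A * (unit_ball_vol m * R ^ m)" if "H \<in> Grass m" for H
  proof -
    have H_Grass: "subspace H" "dim H = m" using that by (auto simp: Grass_def)
    interpret subspace_haar_measure H "subspace_lborel H"
      using H_Grass(1) by (rule subspace_haar_measure_subspace_lborel)
    have "ennreal (section_integral g L H) = (\<integral>\<^sup>+x. ennreal (indicator L x * g x) \<partial>subspace_lborel H)"
      using H_Grass assms by (simp add: nn_integral_subspace_lborel_eq_section_integral)
    also have "\<dots> \<le> (\<integral>\<^sup>+x. ennreal A * indicator (cball 0 R) x \<partial>subspace_lborel H)"
      using g_le L_subset(2) by (intro nn_integral_mono) (auto simp: indicator_def intro: ennreal_leI)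
    also have "\<dots> = ennreal A * emeasure (subspace_lborel H) (cball 0 R)"
      by (rule nn_integral_cmult_indicator) simp
    also have "\<dots> = ennreal (A * (unit_ball_vol m * R ^ m))"
      using H_Grass g_le L_subset by (simp add: emeasure_subspace_lborel_cball flip: ennreal_mult)
    finally show ?thesis using g_le L_subset by (subst (asm) ennreal_le_iff) auto
  qed
  then show ?thesis by (intro bdd_aboveI2)
qed

lemma nn_integral_le_inverse_power_weighted_l1_norm:
  fixes F :: "'a::euclidean_space \<Rightarrow> ennreal"
  assumes c_pos: "\<And>i. i \<in> Basis \<Longrightarrow> c i > 0"
    and support: "\<And>x. F x \<noteq> 0 \<Longrightarrow> weighted_l1_norm c x \<le> 1"
  shows "(\<integral>\<^sup>+x. F x \<partial>lborel) \<le> (\<integral>\<^sup>+x. F x * ennreal (1 / weighted_l1_norm c x ^ k) \<partial>lborel)"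
proof (intro nn_integral_mono_AE eventually_mono[OF AE_lborel_singleton[of 0]])
  fix x :: 'a assume "x \<noteq> 0"
  show "F x \<le> F x * ennreal (1 / weighted_l1_norm c x ^ k)"
  proof (cases "F x = 0")
    case False
    have "weighted_l1_norm c x > 0" using c_pos \<open>x \<noteq> 0\<close> by (rule weighted_l1_norm_pos)
    then have "1 \<le> 1 / weighted_l1_norm c x ^ k"
      using support[OF False] by (simp add: power_le_one)
    then show ?thesis using mult_left_mono[of 1 "ennreal (1 / weighted_l1_norm c x ^ k)" "F x"] by simp
  qed simp
qed

lemma nn_integral_lborel_inverse_power_weighted_l1_norm_le:
  fixes F G :: "'a::euclidean_space \<Rightarrow> ennreal" and c :: "'a \<Rightarrow> real"
  assumes "DIM('a) = m + k" and "m \<ge> 1" and "\<And>j. j \<in> Basis \<Longrightarrow> c j > 0"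
    and [measurable]: "F \<in> borel_measurable borel" "G \<in> borel_measurable borel"
    and "\<And>H. H \<in> Grass m \<Longrightarrow>
      (\<integral>\<^sup>+x. F x \<partial>subspace_lborel H) \<le> C * (\<integral>\<^sup>+x. G x \<partial>subspace_lborel H)"
  shows "(\<integral>\<^sup>+x. F x * ennreal (1 / weighted_l1_norm c x ^ k) \<partial>lborel)
    \<le> C * (\<integral>\<^sup>+x. G x * ennreal (1 / weighted_l1_norm c x ^ k) \<partial>lborel)"
proof (rule subspace_haar_measure_nn_integral_le_transfer)
  have "(UNIV :: 'a set) \<in> Grass (m + k)" using assms(1) by (simp add: Grass_def)
  then show "(\<integral>\<^sup>+x. F x * ennreal (1 / weighted_l1_norm c x ^ k) \<partial>subspace_lborel UNIV)
      \<le> C * (\<integral>\<^sup>+x. G x * ennreal (1 / weighted_l1_norm c x ^ k) \<partial>subspace_lborel UNIV)"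
    using assms(2-) by (intro subspace_lborel_inverse_power_weighted_l1_norm_le) auto
  show "subspace_haar_measure (UNIV :: 'a set) (subspace_lborel UNIV)"
    by (rule subspace_haar_measure_subspace_lborel) simp
  show "subspace_haar_measure (UNIV :: 'a set) lborel" by (rule subspace_haar_measure_lborel)
qed measurable

proposition nn_integral_le_of_sections_le:
  fixes F :: "'a::euclidean_space \<Rightarrow> ennreal" and c :: "'a \<Rightarrow> real" and k :: nat
  defines "n \<equiv> DIM('a)"
  assumes k_bounds: "1 \<le> k" "k < n" and c_pos: "\<And>i. i \<in> Basis \<Longrightarrow> c i > 0"
    and [measurable]: "F \<in> borel_measurable borel"
    and support: "\<And>x. F x \<noteq> 0 \<Longrightarrow> weighted_l1_norm c x \<le> 1"
    and level: "\<And>r. r > 0 \<Longrightarrow> emeasure lborel {x. weighted_l1_norm c x \<le> r} \<le> ennreal (V * r ^ n)" "V > 0"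
    and sections_le: "\<And>H. H \<in> Grass (n - k) \<Longrightarrow> (\<integral>\<^sup>+x. F x \<partial>subspace_lborel H) \<le> ennreal \<epsilon>" "\<epsilon> \<ge> 0"
  shows "(\<integral>\<^sup>+x. F x \<partial>lborel)
    \<le> ennreal (real n / (real n - real k) * c_nk n k * \<epsilon> * V powr (real k / real n))"
proof -
  let ?B = "cball 0 1 :: 'a set" and ?N = "weighted_l1_norm c"
  let ?C = "\<epsilon> / unit_ball_vol (real n - real k)"
  have [measurable]: "indicator ?B \<in> borel_measurable borel" by (intro borel_measurable_indicator) simp
  have "(\<integral>\<^sup>+x. F x \<partial>lborel) \<le> (\<integral>\<^sup>+x. F x * ennreal (1 / ?N x ^ k) \<partial>lborel)"
    using c_pos support by (rule nn_integral_le_inverse_power_weighted_l1_norm)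
  also have "\<dots> \<le> ennreal ?C * (\<integral>\<^sup>+x. indicator ?B x * ennreal (1 / ?N x ^ k) \<partial>lborel)"
  proof (rule nn_integral_lborel_inverse_power_weighted_l1_norm_le[where m = "n - k"])
    fix H :: "'a set" assume H_Grass: "H \<in> Grass (n - k)"
    have "unit_ball_vol (real n - real k) \<noteq> 0"
      using k_bounds by (intro less_imp_neq[symmetric] unit_ball_vol_pos) simp
    moreover have "(\<integral>\<^sup>+x. indicator ?B x \<partial>subspace_lborel H) = ennreal (unit_ball_vol (real n - real k))"
      using H_Grass k_bounds emeasure_subspace_lborel_cball[of H 1] subspace_haar_measure_subspace_lborel[of H]
      by (simp add: Grass_def of_nat_diff subspace_haar_measure.sets_eq_borel)
    ultimately show "(\<integral>\<^sup>+x. F x \<partial>subspace_lborel H) \<le> ennreal ?C * (\<integral>\<^sup>+x. indicator ?B x \<partial>subspace_lborel H)"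
      using sections_le(1)[OF H_Grass] \<open>\<epsilon> \<ge> 0\<close> k_bounds by (simp flip: ennreal_mult)
  qed (use k_bounds c_pos in \<open>auto simp: n_def\<close>)
  also have "\<dots> \<le> ennreal ?C * ennreal (real n / (real n - real k)
      * unit_ball_vol n powr ((real n - real k) / real n) * V powr (real k / real n))"
    using k_bounds level weighted_l1_norm_nonneg[OF c_pos]
    by (intro mult_left_mono lborel.nn_integral_inverse_power_le) (auto simp: n_def emeasure_cball)
  finally show ?thesis
    using k_bounds \<open>\<epsilon> \<ge> 0\<close> by (simp add: c_nk_def mult_ac flip: ennreal_mult)
qed

lemma nn_integral_lborel_eq_integral:
  fixes L :: "'a::euclidean_space set"
  assumes "compact L" "continuous_on L g" "\<And>x. x \<in> L \<Longrightarrow> g x \<ge> 0"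
  shows "(\<integral>\<^sup>+x. ennreal (indicator L x * g x) \<partial>lborel) = ennreal (integral L g)"
proof -
  have integrable: "set_integrable lborel L g"
    using borel_integrable_compact[OF assms(1,2)] by (simp add: set_integrable_def)
  then have "(\<integral>\<^sup>+x. ennreal (indicator L x * g x) \<partial>lborel) = ennreal (\<integral>x. indicator L x * g x \<partial>lborel)"
    using assms(3) by (intro nn_integral_eq_integral) (auto simp: set_integrable_def indicator_def)
  also have "(\<integral>x. indicator L x * g x \<partial>lborel) = integral L g"
    using set_borel_integral_eq_integral(2)[OF integrable] by (simp add: set_lebesgue_integral_def)
  finally show ?thesis .
qed

lemma convex_body_measure_pos:
  fixes L :: "'a::euclidean_space set"
  assumes "convex_body L"
  shows "measure lborel L > 0"
proof -
  obtain e where "e > 0" "cball 0 e \<subseteq> L"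
    using assms by (auto simp: convex_body_def mem_interior_cball)
  then have "0 < measure lborel (cball (0::'a) e)" by (simp add: content_cball)
  also have "\<dots> \<le> measure lborel L"
    using assms \<open>cball 0 e \<subseteq> L\<close>
    by (intro measure_mono_fmeasurable) (auto simp: convex_body_def fmeasurable_compact)
  finally show ?thesis .
qed

lemma SUP_section_integral_nonneg:
  fixes L :: "'a::euclidean_space set"
  assumes "m \<le> DIM('a)" and "compact L" "continuous_on L g" "\<And>x. x \<in> L \<Longrightarrow> g x \<ge> 0"
  shows "(SUP H\<in>Grass m. section_integral g L H) \<ge> 0"
proof -
  obtain S :: "'a set" where "S \<in> Grass m"
    using choose_subspace_of_subspace[of m "UNIV :: 'a set"] assms(1) by (auto simp: Grass_def)
  then have "section_integral g L S \<le> (SUP H\<in>Grass m. section_integral g L H)"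
    using bdd_above_section_integral[OF assms(2-4)] by (rule cSUP_upper)
  moreover have "0 \<le> section_integral g L S" using assms(4) by (rule section_integral_nonneg)
  ultimately show ?thesis by linarith
qed

proposition integral_le_SUP_section_integral:
  fixes L :: "'a::euclidean_space set" and c :: "'a \<Rightarrow> real" and g :: "'a \<Rightarrow> real" and k :: nat
  defines "n \<equiv> DIM('a)"
  assumes k_bounds: "1 \<le> k" "k < n" and L_g: "compact L" "continuous_on L g" "\<And>x. x \<in> L \<Longrightarrow> g x \<ge> 0"
    and c_pos: "\<And>i. i \<in> Basis \<Longrightarrow> c i > 0" and L_subset: "\<And>x. x \<in> L \<Longrightarrow> weighted_l1_norm c x \<le> 1"
    and level: "\<And>r. r > 0 \<Longrightarrow> emeasure lborel {x. weighted_l1_norm c x \<le> r} \<le> ennreal (V * r ^ n)" "V > 0"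
  shows "integral L g \<le> real n / (real n - real k) * c_nk n k
    * (SUP H\<in>Grass (n - k). section_integral g L H) * V powr (real k / real n)"
proof -
  define \<epsilon> where "\<epsilon> = (SUP H\<in>Grass (n - k). section_integral g L H)"
  let ?F = "\<lambda>x. ennreal (indicator L x * g x)"
  have "L \<in> sets borel" using \<open>compact L\<close> by (simp add: borel_closed compact_imp_closed)
  from borel_measurable_continuous_on_indicator[OF this L_g(2)]
  have F_measurable: "?F \<in> borel_measurable borel" by simp
  have "\<epsilon> \<ge> 0" unfolding \<epsilon>_def n_def using L_g by (intro SUP_section_integral_nonneg) auto
  have sections_le: "(\<integral>\<^sup>+x. ?F x \<partial>subspace_lborel H) \<le> ennreal \<epsilon>" if "H \<in> Grass (n - k)" for H
    using that nn_integral_subspace_lborel_eq_section_integral[OF _ L_g]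
      cSUP_upper[OF that bdd_above_section_integral[OF L_g]]
    by (simp add: Grass_def \<epsilon>_def ennreal_leI)
  have support: "weighted_l1_norm c x \<le> 1" if "?F x \<noteq> 0" for x
    using that L_subset by (cases "x \<in> L") auto
  note nn_integral_le_of_sections_le[of k c, folded n_def,
      OF k_bounds c_pos F_measurable support level sections_le \<open>\<epsilon> \<ge> 0\<close>]
  then have "integral L g \<le> real n / (real n - real k) * c_nk n k * \<epsilon> * V powr (real k / real n)"
    using k_bounds \<open>\<epsilon> \<ge> 0\<close> by (simp add: nn_integral_lborel_eq_integral[OF L_g] c_nk_def)
  then show ?thesis by (simp only: \<epsilon>_def)
qed

theorem theorem2:
  fixes L :: "'a::euclidean_space set" and g :: "'a \<Rightarrow> real" and k :: nat
  assumes "DIM('a) \<ge> 2"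
    and "1 \<le> k" and "k < DIM('a)"
    and "convex_body L" and "unconditional L"
    and "continuous_on L g"
    and "\<forall>x\<in>L. g x \<ge> 0"
    and "\<forall>x\<in>L. g (- x) = g x"
  shows "integral L g \<le>
           exp (real k) * (real DIM('a) / (real DIM('a) - real k)) * c_nk DIM('a) k
           * (SUP H\<in>Grass (DIM('a) - k). section_integral g L H)
           * measure lebesgue L powr (real k / real DIM('a))"
proof -
  let ?n = "real DIM('a)" and ?vol = "measure lborel L"
  have "compact L" using assms(4) by (simp add: convex_body_def)
  obtain c where "\<And>i. i \<in> Basis \<Longrightarrow> c i > 0" "\<And>x. x \<in> L \<Longrightarrow> weighted_l1_norm c x \<le> 1"
    and "\<And>r. r > 0 \<Longrightarrow> emeasure lborel {x. weighted_l1_norm c x \<le> r} \<le> ennreal (exp ?n * ?vol * r ^ DIM('a))"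
    using unconditional_in_weighted_cross_polytope[OF assms(4,5)] by metis
  then have "integral L g \<le> ?n / (?n - real k) * c_nk DIM('a) k
      * (SUP H\<in>Grass (DIM('a) - k). section_integral g L H) * (exp ?n * ?vol) powr (real k / ?n)"
    using assms(2,3,6,7) \<open>compact L\<close> convex_body_measure_pos[OF assms(4)]
    by (intro integral_le_SUP_section_integral[where c = c]) auto
  also have "(exp ?n * ?vol) powr (real k / ?n) = exp (real k) * ?vol powr (real k / ?n)"
    by (simp add: powr_mult exp_powr_real)
  also have "?vol = measure lebesgue L"
    using \<open>compact L\<close> by (simp add: measure_completion borel_closed compact_imp_closed)
  finally show ?thesis by (simp add: mult_ac)
qed

end
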